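(* Let $j\in\{1,2\}$ and let $\varphi\in L_1(\mathbb{R})$. Then the condition $1+(H_j\varphi)(y)\neq0$ for all $y\in\mathbb{R}$ is necessary and sufficient for the existence of a function $\ell\in L_1(\mathbb{R})$ such that $$(H_j\ell)(y)=\frac{(H_j\varphi)(y)}{1+(H_j\varphi)(y)}\quad\text{for every }y\in\mathbb{R}.$$
   Context: The Hartley transforms are $(H_1f)(y)=\frac{1}{\sqrt{2\pi}}\int_{\mathbb{R}}f(x)(\cos(xy)+\sin(xy))\,dx$ and $(H_2f)(y)=\frac{1}{\sqrt{2\pi}}\int_{\mathbb{R}}f(x)(\cos(xy)-\sin(xy))\,dx$, $y\in\mathbb{R}$. *)

theory Defs
  imports "HOL-Analysis.Analysis"
begin

text \<open>
  Elements of \<open>L\<^sub>1(\<real>)\<close> are represented by complex-valued Lebesgue integrable functions; the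
  transforms do not depend on the representative of an almost-everywhere class.
\<close>

definition hartley1 :: "(real \<Rightarrow> complex) \<Rightarrow> real \<Rightarrow> complex" where
  "hartley1 f y =
     complex_of_real (1 / sqrt (2 * pi)) *
     (LINT x|lebesgue. f x * complex_of_real (cos (x * y) + sin (x * y)))"

definition hartley2 :: "(real \<Rightarrow> complex) \<Rightarrow> real \<Rightarrow> complex" where
  "hartley2 f y =
     complex_of_real (1 / sqrt (2 * pi)) *
     (LINT x|lebesgue. f x * complex_of_real (cos (x * y) - sin (x * y)))"

end

theory Submission
  imports Defs "HOL-Probability.Probability"
begin

text \<open>
  Both Hartley transforms of \<open>\<phi>\<close> have the form
  \<open>c (a F(y) + b F(-y))\<close> with \<open>F\<close> the Fourier transform of \<open>\<phi>\<close>,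
  \<open>a = (1 \<plusminus> \<i>)/2\<close> and \<open>b\<close> the conjugate of \<open>a\<close>. Hence each of them is the
  Fourier transform of \<open>c (a \<phi>(x) + b \<phi>(-x))\<close>, and since \<open>2 a b = 1\<close> and
  \<open>a\<^sup>2 + b\<^sup>2 = 0\<close> this change of function is invertible on integrable functions. The
  sufficiency is therefore Wiener's lemma for the Fourier transform: if \<open>f\<close> is integrable and
  \<open>1 + fourier f\<close> has no zero, then \<open>fourier f / (1 + fourier f)\<close> is the Fourier transform of an
  integrable function.

  The proof of Wiener's lemma follows Newman's argument for absolutely convergent Fourier series.
  By the Riemann-Lebesgue lemma and continuity, \<open>\<bar>1 + fourier f\<bar> \<ge> 3d\<close> for some
  \<open>d > 0\<close>. The transform \<open>fourier f\<close> is approximated within \<open>d\<close>, in the norm that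
  transforms inherit from \<open>L\<^sub>1\<close>, by a twice differentiable function \<open>h\<close> with quadratic
  decay; then \<open>\<bar>1 + h\<bar> \<ge> 2d\<close>, and
  \<open>1 / (1 + fourier f) = (\<Sum>n. (h - fourier f)^n / (1 + h)^(n + 1))\<close>.
  The norm of \<open>(h - fourier f)^n\<close> is at most \<open>d^n\<close>, because convolution makes the norm
  submultiplicative. The norm of \<open>(1 + h)^(-n) - 1\<close> is controlled by pointwise bounds for this
  function and its first two derivatives, hence grows like \<open>n\<^sup>2 (2d)^(-n)\<close> only.
  So the series converges in the norm.

  Two analytic facts support this. A twice differentiable function with quadratic decay is the
  transform of an integrable function, which is the Fourier inversion formula
  (\<open>fourier_inversion\<close>, \<open>wiener_smooth_decay\<close>). Such functions are dense
  (\<open>integrable_approximable\<close>): the transforms \<open>exp(-\<i>ay)/(1 + \<i>y)\<close> of translated one-sided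
  exponentials are approximated by dividing them by \<open>1 + \<i>sy\<close> with small \<open>s\<close>, and these
  exponentials span a dense subspace of \<open>L\<^sub>1\<close>.

  For the necessity, division by zero yields zero, so the equation for \<open>l\<close> makes sense also at
  zeros of \<open>1 + H \<phi>\<close>. Where \<open>1 + H \<phi>\<close> vanishes, \<open>H l\<close> vanishes too; elsewhere
  \<open>H l (1 + H \<phi>) = H \<phi>\<close>, an equation that fails at every zero. Since both transforms are
  continuous, the zero set is open and closed, and it is not the whole line because
  \<open>H \<phi>\<close> tends to zero at infinity.
\<close>

section \<open>Fourier transforms of integrable functions\<close>

definition fourier :: "(real \<Rightarrow> complex) \<Rightarrow> real \<Rightarrow> complex" where
  "fourier f y = (LINT x|lborel. f x * cis (- (x * y)))"

lemma cis_measurable [measurable]: "cis \<in> borel_measurable borel"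
  by (intro borel_measurable_continuous_onI continuous_intros)

lemma integrable_fourier:
  assumes "integrable lborel f"
  shows "integrable lborel (\<lambda>x. f x * cis (- (x * y)))"
proof (rule Bochner_Integration.integrable_bound [OF assms])
  show "(\<lambda>x. f x * cis (- (x * y))) \<in> borel_measurable lborel"
    using assms by measurable
qed (simp add: norm_mult)

lemma norm_fourier_le:
  assumes "integrable lborel f"
  shows "norm (fourier f y) \<le> (LINT x|lborel. norm (f x))"
  using integral_norm_bound [of lborel "\<lambda>x. f x * cis (- (x * y))"]
  by (simp add: fourier_def norm_mult)

lemma continuous_on_fourier:
  assumes "integrable lborel f"
  shows "continuous_on A (fourier f)"
proof -
  have "isCont (fourier f) y" for y
    unfolding continuous_at_sequentially o_def
  proof (intro allI impI)
    fix u assume u: "u \<longlonglongrightarrow> y"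
    show "(\<lambda>n. fourier f (u n)) \<longlonglongrightarrow> fourier f y"
      unfolding fourier_def
    proof (rule integral_dominated_convergence [where w = "\<lambda>x. norm (f x)"])
      show "AE x in lborel. (\<lambda>n. f x * cis (- (x * u n))) \<longlonglongrightarrow> f x * cis (- (x * y))"
        by (intro AE_I2 tendsto_mult tendsto_const tendsto_cis tendsto_minus u)
    qed (use assms in \<open>auto simp: norm_mult intro!: borel_measurable_integrable integrable_fourier\<close>)
  qed
  then show ?thesis
    by (simp add: continuous_at_imp_continuous_on)
qed

lemma fourier_add:
  "integrable lborel f \<Longrightarrow> integrable lborel g \<Longrightarrow> fourier (\<lambda>x. f x + g x) y = fourier f y + fourier g y"
  using integrable_fourier [of f y] integrable_fourier [of g y] by (simp add: fourier_def distrib_right)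

lemma fourier_cmult: "fourier (\<lambda>x. c * f x) y = c * fourier f y"
  by (simp add: fourier_def mult.assoc)

lemma fourier_translate: "fourier (\<lambda>x. f (x - a)) y = cis (- (a * y)) * fourier f y"
proof -
  have "fourier (\<lambda>x. f (x - a)) y = (LINT x|lborel. f x * cis (- ((a + x) * y)))"
    unfolding fourier_def
    using lborel_integral_real_affine [of 1 "\<lambda>x. f (x - a) * cis (- (x * y))" a] by simp
  also have "\<dots> = (LINT x|lborel. cis (- (a * y)) * (f x * cis (- (x * y))))"
    by (simp add: algebra_simps cis_mult)
  also have "\<dots> = cis (- (a * y)) * fourier f y"
    by (simp add: fourier_def)
  finally show ?thesis .
qed

section \<open>The algebra of Fourier transforms\<close>

text \<open>
  The norm that Fourier transforms inherit from \<open>L\<^sub>1\<close>, as a relation: bounds for sums, products and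
  series then combine directly, without infima over preimages.
\<close>

definition wiener_le :: "(real \<Rightarrow> complex) \<Rightarrow> real \<Rightarrow> bool" where
  "wiener_le h c \<longleftrightarrow> (\<exists>g. integrable lborel g \<and> (\<forall>y. fourier g y = h y) \<and> (LINT x|lborel. norm (g x)) \<le> c)"

lemma wiener_leI:
  "integrable lborel g \<Longrightarrow> (\<And>y. fourier g y = h y) \<Longrightarrow> (LINT x|lborel. norm (g x)) \<le> c \<Longrightarrow> wiener_le h c"
  unfolding wiener_le_def by blast

lemma wiener_fourier: "integrable lborel f \<Longrightarrow> wiener_le (fourier f) (LINT x|lborel. norm (f x))"
  by (rule wiener_leI) auto

lemma wiener_mono: "wiener_le h c \<Longrightarrow> c \<le> d \<Longrightarrow> wiener_le h d"
  unfolding wiener_le_def by (meson order_trans)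

lemma wiener_sup_bound: "wiener_le h c \<Longrightarrow> norm (h y) \<le> c"
  unfolding wiener_le_def by (metis norm_fourier_le order_trans)

lemma wiener_cmult:
  assumes "wiener_le h c"
  shows "wiener_le (\<lambda>y. k * h y) (norm k * c)"
proof -
  obtain g where g: "integrable lborel g" "\<And>y. fourier g y = h y" "(LINT x|lborel. norm (g x)) \<le> c"
    using assms unfolding wiener_le_def by blast
  show ?thesis
  proof (rule wiener_leI [where g = "\<lambda>x. k * g x"])
    show "fourier (\<lambda>x. k * g x) y = k * h y" for y
      by (simp add: fourier_cmult g(2))
  qed (use g in \<open>auto simp: norm_mult mult_left_mono\<close>)
qed

lemma wiener_add:
  assumes "wiener_le h c" "wiener_le k d"
  shows "wiener_le (\<lambda>y. h y + k y) (c + d)"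
proof -
  obtain f where f: "integrable lborel f" "\<And>y. fourier f y = h y" "(LINT x|lborel. norm (f x)) \<le> c"
    using assms(1) unfolding wiener_le_def by blast
  obtain g where g: "integrable lborel g" "\<And>y. fourier g y = k y" "(LINT x|lborel. norm (g x)) \<le> d"
    using assms(2) unfolding wiener_le_def by blast
  show ?thesis
  proof (rule wiener_leI [where g = "\<lambda>x. f x + g x"])
    show "fourier (\<lambda>x. f x + g x) y = h y + k y" for y
      by (simp add: fourier_add f g)
    have "(LINT x|lborel. norm (f x + g x)) \<le> (LINT x|lborel. norm (f x) + norm (g x))"
      using f(1) g(1) by (intro integral_mono) (auto intro: norm_triangle_ineq)
    also have "\<dots> \<le> c + d"
      using f g by simp
    finally show "(LINT x|lborel. norm (f x + g x)) \<le> c + d" .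
  qed (use f g in auto)
qed

lemma wiener_diff:
  assumes "wiener_le h c" "wiener_le k d"
  shows "wiener_le (\<lambda>y. h y - k y) (c + d)"
  using wiener_add [OF assms(1) wiener_cmult [OF assms(2), of "-1"]] by simp

text \<open>
  The product is the transform of the convolution; Fubini's theorem gives both the norm bound and
  the transform.
\<close>

lemma wiener_mult:
  assumes "wiener_le h c" "wiener_le k d"
  shows "wiener_le (\<lambda>y. h y * k y) (c * d)"
proof -
  obtain f where f: "integrable lborel f" "\<And>y. fourier f y = h y" "(LINT x|lborel. norm (f x)) \<le> c"
    using assms(1) unfolding wiener_le_def by blast
  obtain g where g: "integrable lborel g" "\<And>y. fourier g y = k y" "(LINT x|lborel. norm (g x)) \<le> d"
    using assms(2) unfolding wiener_le_def by blast
  have [measurable]: "f \<in> borel_measurable borel" "g \<in> borel_measurable borel"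
    using f(1) g(1) by auto
  define F where "F = (\<lambda>t x. g t * f (x - t))"
  have [measurable]: "case_prod F \<in> borel_measurable (lborel \<Otimes>\<^sub>M lborel)"
    unfolding F_def by measurable
  \<comment> \<open>\<open>F\<close> is the integrand of the convolution, so translation invariance of the measure gives its inner integrals.\<close>
  have shift: "integrable lborel (\<lambda>x. f (x - t))" for t
    using lborel_integrable_real_affine [OF f(1), of 1 "-t"] by simp
  have norm_shift: "(LINT x|lborel. norm (f (x - t))) = (LINT x|lborel. norm (f x))" for t
    using lborel_integral_real_affine [of 1 "\<lambda>x. norm (f x)" "-t"] by simp
  have F1: "(LINT x|lborel. norm (F t x)) = norm (g t) * (LINT x|lborel. norm (f x))" for t
    by (simp add: F_def norm_mult norm_shift)
  have F: "integrable (lborel \<Otimes>\<^sub>M lborel) (case_prod F)"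
  proof (rule lborel_pair.Fubini_integrable)
    show "integrable lborel (\<lambda>x. LINT y|lborel. norm (case (x, y) of (x, y) \<Rightarrow> F x y))"
      using g(1) by (simp add: F1)
    show "AE x in lborel. integrable lborel (\<lambda>y. case (x, y) of (x, y) \<Rightarrow> F x y)"
      using shift by (simp add: F_def)
  qed measurable
  show ?thesis
  proof (rule wiener_leI [where g = "\<lambda>x. LINT t|lborel. F t x"])
    show "integrable lborel (\<lambda>x. LINT t|lborel. F t x)"
      using lborel_pair.integrable_snd [OF F] .
    have "(LINT x|lborel. norm (LINT t|lborel. F t x)) \<le> (LINT x|lborel. LINT t|lborel. norm (F t x))"
    proof (rule integral_mono)
      show "integrable lborel (\<lambda>x. LINT t|lborel. norm (F t x))"
        using lborel_pair.integrable_snd [of "\<lambda>t x. norm (F t x)"] integrable_norm [OF F]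
        by (simp add: case_prod_unfold)
    qed (use lborel_pair.integrable_snd [OF F] in auto)
    also have "\<dots> = (LINT t|lborel. LINT x|lborel. norm (F t x))"
      using integrable_norm [OF F] by (intro lborel_pair.Fubini_integral) (simp add: case_prod_unfold)
    also have "\<dots> = (LINT t|lborel. norm (g t)) * (LINT x|lborel. norm (f x))"
      by (simp add: F1)
    also have "\<dots> \<le> d * c"
      using f(3) g(3) by (intro mult_mono) (auto intro: order_trans[rotated])
    finally show "(LINT x|lborel. norm (LINT t|lborel. F t x)) \<le> c * d"
      by (simp add: mult.commute)
    show "fourier (\<lambda>x. LINT t|lborel. F t x) y = h y * k y" for y
    proof -
      have "integrable (lborel \<Otimes>\<^sub>M lborel) (\<lambda>(t, x). F t x * cis (- (x * y)))"
        by (rule Bochner_Integration.integrable_bound [OF F]) (auto simp: norm_mult case_prod_unfold)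
      from lborel_pair.Fubini_integral [OF this]
      have "fourier (\<lambda>x. LINT t|lborel. F t x) y = (LINT t|lborel. LINT x|lborel. F t x * cis (- (x * y)))"
        by (simp add: fourier_def)
      also have "\<dots> = (LINT t|lborel. g t * cis (- (t * y)) * h y)"
      proof (rule Bochner_Integration.integral_cong [OF refl])
        fix t
        have "(LINT x|lborel. F t x * cis (- (x * y)))
            = (LINT x|lborel. g t * (f (x - t) * cis (- (x * y))))"
          by (simp add: F_def mult.assoc)
        also have "\<dots> = g t * (LINT x|lborel. f (x - t) * cis (- (x * y)))"
          by simp
        also have "(LINT x|lborel. f (x - t) * cis (- (x * y))) = cis (- (t * y)) * h y"
          using fourier_translate [of f t y] by (simp only: f(2)) (simp add: fourier_def)
        finally show "(LINT x|lborel. F t x * cis (- (x * y))) = g t * cis (- (t * y)) * h y"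
          by (simp add: mult.assoc)
      qed
      also have "\<dots> = h y * k y"
        by (simp add: g(2) [symmetric] fourier_def)
      finally show ?thesis .
    qed
  qed
qed

text \<open>
  Completeness of \<open>L\<^sub>1\<close>: preimages with summable norms sum almost everywhere to an integrable
  function, and the transform may be taken term by term.
\<close>

lemma wiener_suminf:
  assumes h: "\<And>n. wiener_le (h n) (c n)" and "summable c"
  shows "wiener_le (\<lambda>y. \<Sum>n. h n y) (\<Sum>n. c n)"
proof -
  obtain g where g: "\<And>n. integrable lborel (g n)" "\<And>n y. fourier (g n) y = h n y"
    "\<And>n. (LINT x|lborel. norm (g n x)) \<le> c n"
    using h unfolding wiener_le_def by metis
  have [measurable]: "g n \<in> borel_measurable borel" for n
    using g(1) by auto
  have sum: "summable (\<lambda>n. LINT x|lborel. norm (g n x))"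
    using g(3) by (intro summable_comparison_test' [OF \<open>summable c\<close>, of 0]) simp
  have "(\<integral>\<^sup>+x. (\<Sum>n. ennreal (norm (g n x))) \<partial>lborel) = (\<Sum>n. \<integral>\<^sup>+x. ennreal (norm (g n x)) \<partial>lborel)"
    by (intro nn_integral_suminf) auto
  also have "\<dots> = (\<Sum>n. ennreal (LINT x|lborel. norm (g n x)))"
    using g(1) by (intro suminf_cong nn_integral_eq_integral) auto
  also have "\<dots> \<noteq> \<infinity>"
    using sum by (simp add: ennreal_suminf_neq_top)
  finally have "AE x in lborel. (\<Sum>n. ennreal (norm (g n x))) \<noteq> \<infinity>"
    by (intro nn_integral_PInf_AE) auto
  then have AE_sum: "AE x in lborel. summable (\<lambda>n. norm (g n x))"
    by eventually_elim (auto intro: summable_suminf_not_top)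
  show ?thesis
  proof (rule wiener_leI [where g = "\<lambda>x. \<Sum>n. g n x"])
    show "integrable lborel (\<lambda>x. \<Sum>n. g n x)"
      by (rule integrable_suminf) (use g AE_sum sum in auto)
    have "(LINT x|lborel. norm (\<Sum>n. g n x)) \<le> (LINT x|lborel. (\<Sum>n. norm (g n x)))"
    proof (rule integral_mono_AE)
      show "integrable lborel (\<lambda>x. \<Sum>n. norm (g n x))"
        by (rule integrable_suminf) (use g AE_sum sum in auto)
      show "AE x in lborel. norm (\<Sum>n. g n x) \<le> (\<Sum>n. norm (g n x))"
        using AE_sum by eventually_elim (rule summable_norm)
    qed (intro integrable_norm integrable_suminf; use g AE_sum sum in auto)
    also have "\<dots> = (\<Sum>n. LINT x|lborel. norm (g n x))"
      by (rule integral_suminf) (use g AE_sum sum in auto)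
    also have "\<dots> \<le> (\<Sum>n. c n)"
      using g(3) sum \<open>summable c\<close> by (intro suminf_le) auto
    finally show "(LINT x|lborel. norm (\<Sum>n. g n x)) \<le> (\<Sum>n. c n)" .
    fix y
    have "fourier (\<lambda>x. \<Sum>n. g n x) y = (LINT x|lborel. (\<Sum>n. g n x * cis (- (x * y))))"
      unfolding fourier_def
    proof (rule integral_cong_AE)
      show "AE x in lborel. (\<Sum>n. g n x) * cis (- (x * y)) = (\<Sum>n. g n x * cis (- (x * y)))"
        using AE_sum by eventually_elim (auto intro: suminf_mult2 summable_norm_cancel)
    qed auto
    also have "\<dots> = (\<Sum>n. h n y)"
      unfolding g(2) [symmetric] fourier_def
      by (rule integral_suminf) (use g AE_sum sum integrable_fourier in \<open>auto simp: norm_mult\<close>)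
    finally show "fourier (\<lambda>x. \<Sum>n. g n x) y = (\<Sum>n. h n y)" .
  qed
qed

lemma wiener_modulation:
  assumes "wiener_le h c"
  shows "wiener_le (\<lambda>y. cis (- (a * y)) * h y) c"
proof -
  obtain g where g: "integrable lborel g" "\<And>y. fourier g y = h y" "(LINT x|lborel. norm (g x)) \<le> c"
    using assms unfolding wiener_le_def by blast
  show ?thesis
  proof (rule wiener_leI [where g = "\<lambda>x. g (x - a)"])
    show "integrable lborel (\<lambda>x. g (x - a))"
      using lborel_integrable_real_affine [OF g(1), of 1 "-a"] by simp
    show "(LINT x|lborel. norm (g (x - a))) \<le> c"
      using g(3) lborel_integral_real_affine [of 1 "\<lambda>x. norm (g x)" "-a"] by simp
    show "fourier (\<lambda>x. g (x - a)) y = cis (- (a * y)) * h y" for y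
      by (simp only: fourier_translate g(2))
  qed
qed

section \<open>Fourier inversion\<close>

lemma integrable_quadratic_decay: "integrable lborel (\<lambda>x::real. M / (1 + x\<^sup>2))"
  and integral_quadratic_decay: "(LINT x|lborel. M / (1 + x\<^sup>2)) = M * pi"
  using integrable_inverse_1_plus_square LBINT_inverse_1_plus_square
  by (simp_all add: set_integrable_def interval_lebesgue_integral_def set_lebesgue_integral_def
      divide_inverse)

lemma integrable_if_quadratic_decay:
  fixes h :: "real \<Rightarrow> complex"
  assumes "continuous_on UNIV h" "\<And>y. norm (h y) \<le> M / (1 + y\<^sup>2)"
  shows "integrable lborel h"
proof (rule Bochner_Integration.integrable_bound [OF integrable_quadratic_decay])
  show "h \<in> borel_measurable lborel"
    using assms(1) by (simp add: borel_measurable_continuous_onI)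
  show "AE x in lborel. norm (h x) \<le> norm (M / (1 + x\<^sup>2))"
    using assms(2) by (intro AE_I2) (metis norm_ge_zero order_trans real_norm_def abs_of_nonneg)
qed

lemma has_vector_derivative_cis_linear:
  "((\<lambda>x. cis (- (x * y))) has_vector_derivative (- \<i> * y * cis (- (x * y)))) (at x)"
  unfolding has_vector_derivative_def
  by (auto intro!: derivative_eq_intros simp: scaleR_conv_of_real algebra_simps)

lemma fourier_derivative:
  assumes h: "\<And>y. (h has_vector_derivative h' y) (at y)" and h': "continuous_on UNIV h'"
    and b: "\<And>y. norm (h y) \<le> M / (1 + y\<^sup>2)" "\<And>y. norm (h' y) \<le> M / (1 + y\<^sup>2)"
  shows "fourier h' y = \<i> * y * fourier h y"
proof -
  have contH: "continuous_on UNIV h"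
    using h by (meson continuous_at_imp_continuous_on has_vector_derivative_continuous)
  have int: "integrable lborel h" "integrable lborel h'"
    using contH h' b by (auto intro: integrable_if_quadratic_decay)
  let ?F = "\<lambda>x. h x * cis (- (x * y))"
  let ?f = "\<lambda>x. h' x * cis (- (x * y)) - \<i> * y * (h x * cis (- (x * y)))"
  have int_f: "integrable lborel ?f"
    using int by (intro Bochner_Integration.integrable_diff integrable_mult_right integrable_fourier)
  have null: "((\<lambda>x. M / (1 + x\<^sup>2)) \<longlongrightarrow> 0) at_top" "((\<lambda>x. M / (1 + x\<^sup>2)) \<longlongrightarrow> 0) at_bot"
    by real_asymp+
  have "(LBINT x=-\<infinity>..\<infinity>. ?f x) = 0 - 0"
  proof (rule interval_integral_FTC_integrable)
    show "(?F has_vector_derivative ?f x) (at x)" for x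
      by (rule has_vector_derivative_eq_rhs
          [OF has_vector_derivative_mult [OF h has_vector_derivative_cis_linear]]) (simp add: algebra_simps)
    have "continuous_on UNIV ?f"
      by (intro continuous_intros contH h')
    then show "isCont ?f x" for x
      by (simp add: continuous_on_eq_continuous_at)
    show "set_integrable lborel (einterval (-\<infinity>) \<infinity>) ?f"
      using int_f by (simp add: set_integrable_def)
    show "((?F \<circ> real_of_ereal) \<longlongrightarrow> 0) (at_right (-\<infinity>))"
      unfolding ereal_tendsto_simps
      by (rule Lim_null_comparison [OF _ null(2)]) (use b in \<open>auto simp: norm_mult\<close>)
    show "((?F \<circ> real_of_ereal) \<longlongrightarrow> 0) (at_left \<infinity>)"
      unfolding ereal_tendsto_simps
      by (rule Lim_null_comparison [OF _ null(1)]) (use b in \<open>auto simp: norm_mult\<close>)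
  qed auto
  then have "(LINT x|lborel. ?f x) = 0"
    by (simp add: interval_lebesgue_integral_def set_lebesgue_integral_def)
  then show ?thesis
    using int integrable_fourier by (simp add: fourier_def)
qed

lemma fourier_std_normal_density:
  "(LINT s|lborel. of_real (std_normal_density s) * cis (s * u)) = of_real (exp (- u\<^sup>2 / 2))"
proof -
  have "(LINT s|lborel. of_real (std_normal_density s) * cis (s * u)) = char std_normal_distribution u"
    unfolding char_def
    by (subst integral_density) (auto simp: cis_conv_exp scaleR_conv_of_real mult_ac)
  then show ?thesis
    by (simp add: char_std_normal_distribution)
qed

text \<open>
  The Gaussian factor \<open>G (\<epsilon> x)\<close> makes the double integral absolutely convergent. Exchanging the
  order of integration turns it into an average of \<open>h\<close> around \<open>y\<close> with respect to a normal density
  of width \<open>\<epsilon>\<close>, because the normal density is its own transform up to a constant. Both sides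
  converge as \<open>\<epsilon>\<close> tends to zero.
\<close>

theorem fourier_inversion:
  fixes h :: "real \<Rightarrow> complex"
  assumes h: "continuous_on UNIV h" "integrable lborel h" "\<And>t. norm (h t) \<le> B"
    and g: "integrable lborel (\<lambda>x. fourier h (- x))"
  shows "fourier (\<lambda>x. fourier h (- x)) y = 2 * pi * h y"
proof -
  define e where "e n = 1 / real (Suc n)" for n
  have e: "e n > 0" for n
    by (simp add: e_def)
  have e0: "e \<longlonglongrightarrow> 0"
    unfolding e_def using LIMSEQ_inverse_real_of_nat by (simp add: divide_inverse)
  define G :: "real \<Rightarrow> complex" where "G s = of_real (std_normal_density s)" for s
  have G: "integrable lborel G"
    unfolding G_def using integrable_normal_density [of 1 0] by (intro integrable_of_real) simp
  have [measurable]: "h \<in> borel_measurable borel" "G \<in> borel_measurable borel"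
    using h(2) G by auto
  have contG: "continuous_on UNIV G"
    unfolding G_def std_normal_density_def by (intro continuous_intros) auto
  have eq: "(LINT x|lborel. fourier h (- x) * cis (- (x * y)) * G (e n * x))
      = sqrt (2 * pi) * (LINT s|lborel. h (y + e n * s) * G s)" for n
  proof -
    let ?F = "\<lambda>t x. h t * cis (x * (t - y)) * G (e n * x)"
    have G': "integrable lborel (\<lambda>x. G (e n * x))"
      using lborel_integrable_real_affine [OF G, of "e n" 0] e[of n] by simp
    have F: "integrable (lborel \<Otimes>\<^sub>M lborel) (case_prod ?F)"
    proof (rule lborel_pair.Fubini_integrable)
      show "integrable lborel (\<lambda>x. LINT y|lborel. norm (case (x, y) of (x, y) \<Rightarrow> ?F x y))"
        using h(2) by (simp add: norm_mult)
      show "AE x in lborel. integrable lborel (\<lambda>y. case (x, y) of (x, y) \<Rightarrow> ?F x y)"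
      proof (intro AE_I2)
        fix t
        have "integrable lborel (?F t)"
        proof (rule Bochner_Integration.integrable_bound)
          show "integrable lborel (\<lambda>x. h t * G (e n * x))"
            using G' by simp
        qed (auto simp: norm_mult)
        then show "integrable lborel (\<lambda>y. case (t, y) of (x, y) \<Rightarrow> ?F x y)"
          by simp
      qed
    qed measurable
    \<comment> \<open>Substituting \<open>x = s / e n\<close> leaves the transform of the normal density at \<open>(t - y) / e n\<close>.\<close>
    have inner: "(LINT x|lborel. ?F t x) = h t * (sqrt (2 * pi) * G ((t - y) / e n) / e n)" for t
    proof -
      have "(LINT x|lborel. cis (x * (t - y)) * G (e n * x))
          = (1 / e n) *\<^sub>R (LINT s|lborel. cis (s * ((t - y) / e n)) * G s)"
        using lborel_integral_real_affine
            [of "1 / e n" "\<lambda>x. cis (x * (t - y)) * G (e n * x)" 0] e[of n] by simp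
      also have "\<dots> = (1 / e n) *\<^sub>R of_real (exp (- ((t - y) / e n)\<^sup>2 / 2))"
        using fourier_std_normal_density [of "(t - y) / e n"] by (simp add: G_def mult.commute)
      also have "\<dots> = sqrt (2 * pi) * G ((t - y) / e n) / e n"
        by (simp add: G_def std_normal_density_def scaleR_conv_of_real)
      finally show ?thesis
        by (simp add: mult.assoc)
    qed
    have "(LINT x|lborel. fourier h (- x) * cis (- (x * y)) * G (e n * x))
        = (LINT x|lborel. LINT t|lborel. ?F t x)"
    proof (rule Bochner_Integration.integral_cong [OF refl])
      fix x
      have "fourier h (- x) * cis (- (x * y)) * G (e n * x)
          = (LINT t|lborel. h t * cis (t * x) * (cis (- (x * y)) * G (e n * x)))"
        using integrable_fourier [OF h(2), of "-x"] by (simp add: fourier_def)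
      also have "\<dots> = (LINT t|lborel. ?F t x)"
      proof (rule Bochner_Integration.integral_cong [OF refl])
        fix t
        have "cis (t * x) * cis (- (x * y)) = cis (x * (t - y))"
          by (simp add: cis_mult algebra_simps)
        then show "h t * cis (t * x) * (cis (- (x * y)) * G (e n * x)) = ?F t x"
          by (simp add: mult.assoc [symmetric])
      qed
      finally show "fourier h (- x) * cis (- (x * y)) * G (e n * x) = (LINT t|lborel. ?F t x)" .
    qed
    also have "\<dots> = (LINT t|lborel. LINT x|lborel. ?F t x)"
      by (rule lborel_pair.Fubini_integral [OF F])
    also have "\<dots> = (LINT t|lborel. h t * (sqrt (2 * pi) * G ((t - y) / e n) / e n))"
      by (simp only: inner)
    also have "\<dots> = \<bar>e n\<bar> *\<^sub>R (LINT s|lborel. h (y + e n * s) * (sqrt (2 * pi) * G s / e n))"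
      using lborel_integral_real_affine
          [of "e n" "\<lambda>t. h t * (sqrt (2 * pi) * G ((t - y) / e n) / e n)" y] e[of n] by simp
    also have "\<dots> = \<bar>e n\<bar> *\<^sub>R (LINT s|lborel. (sqrt (2 * pi) / e n) * (h (y + e n * s) * G s))"
      by (simp add: mult_ac)
    also have "\<dots> = sqrt (2 * pi) * (LINT s|lborel. h (y + e n * s) * G s)"
      using e[of n] by (simp add: scaleR_conv_of_real)
    finally show ?thesis .
  qed
  have arg0: "(\<lambda>n. c + e n * s) \<longlonglongrightarrow> c" for c s
    using tendsto_add [OF tendsto_const tendsto_mult_left_zero [OF e0]] by simp
  have "(\<lambda>n. LINT x|lborel. fourier h (- x) * cis (- (x * y)) * G (e n * x))
      \<longlonglongrightarrow> (LINT x|lborel. fourier h (- x) * cis (- (x * y)) * G 0)"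
  proof (rule integral_dominated_convergence [where w = "\<lambda>x. norm (fourier h (- x))"])
    show "AE x in lborel. (\<lambda>n. fourier h (- x) * cis (- (x * y)) * G (e n * x))
        \<longlonglongrightarrow> fourier h (- x) * cis (- (x * y)) * G 0"
      using arg0 [of 0]
      by (intro AE_I2 tendsto_mult tendsto_const continuous_on_tendsto_compose [OF contG]) auto
    show "AE x in lborel. norm (fourier h (- x) * cis (- (x * y)) * G (e n * x))
        \<le> norm (fourier h (- x))" for n
    proof (intro AE_I2)
      fix x
      have "norm (G (e n * x)) \<le> 1"
      proof -
        have "1 \<le> sqrt (2 * pi)" using pi_gt3 by simp
        then have "std_normal_density (e n * x) \<le> 1 * 1"
          unfolding std_normal_density_def by (intro mult_mono) auto
        then show ?thesis by (simp add: G_def normal_density_nonneg)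
      qed
      then show "norm (fourier h (- x) * cis (- (x * y)) * G (e n * x)) \<le> norm (fourier h (- x))"
        by (simp add: norm_mult mult_left_le)
    qed
  qed (use g in \<open>auto intro!: borel_measurable_times dest: borel_measurable_integrable\<close>)
  also have "(LINT x|lborel. fourier h (- x) * cis (- (x * y)) * G 0)
      = fourier (\<lambda>x. fourier h (- x)) y / sqrt (2 * pi)"
    using integrable_fourier [OF g, of y] by (simp add: fourier_def G_def std_normal_density_def)
  finally have l1: "(\<lambda>n. sqrt (2 * pi) * (LINT s|lborel. h (y + e n * s) * G s))
      \<longlonglongrightarrow> fourier (\<lambda>x. fourier h (- x)) y / sqrt (2 * pi)"
    by (simp only: eq)
  have "(\<lambda>n. LINT s|lborel. h (y + e n * s) * G s) \<longlonglongrightarrow> (LINT s|lborel. h y * G s)"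
  proof (rule integral_dominated_convergence [where w = "\<lambda>s. B * norm (G s)"])
    show "AE s in lborel. (\<lambda>n. h (y + e n * s) * G s) \<longlonglongrightarrow> h y * G s"
      using arg0 [of y]
      by (intro AE_I2 tendsto_mult tendsto_const continuous_on_tendsto_compose [OF h(1)]) auto
    show "AE s in lborel. norm (h (y + e n * s) * G s) \<le> B * norm (G s)" for n
      using h(3) by (intro AE_I2) (simp add: norm_mult mult_right_mono)
  qed (use G in auto)
  also have "(LINT s|lborel. h y * G s) = h y"
    using G unfolding G_def by (simp add: integral_complex_of_real)
  finally have "(\<lambda>n. sqrt (2 * pi) * (LINT s|lborel. h (y + e n * s) * G s)) \<longlonglongrightarrow> sqrt (2 * pi) * h y"
    by (intro tendsto_mult tendsto_const)
  from LIMSEQ_unique [OF l1 this]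
  have eq_lim: "fourier (\<lambda>x. fourier h (- x)) y / sqrt (2 * pi) = sqrt (2 * pi) * h y" .
  define r where "r = complex_of_real (sqrt (2 * pi))"
  have r: "r \<noteq> 0" "r * r = 2 * pi"
    unfolding r_def by (simp, simp flip: of_real_mult del: real_sqrt_mult)
  have "fourier (\<lambda>x. fourier h (- x)) y = r * r * h y"
    using eq_lim r(1) unfolding r_def [symmetric] by (simp add: divide_eq_eq mult_ac)
  then show ?thesis
    by (simp only: r(2))
qed

text \<open>
  The dense class in which powers of \<open>1 / (1 + h)\<close> can be estimated: all conditions are pointwise
  bounds, so they only see the supremum of \<open>1 / \<bar>1 + h\<bar>\<close>. Two derivatives are what makes the
  inverse transform decay quadratically.
\<close>

definition smooth_decay :: "(real \<Rightarrow> complex) \<Rightarrow> real \<Rightarrow> bool" where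
  "smooth_decay h M \<longleftrightarrow> (\<exists>h' h''.
     (\<forall>y. (h has_vector_derivative h' y) (at y)) \<and> (\<forall>y. (h' has_vector_derivative h'' y) (at y)) \<and>
     continuous_on UNIV h'' \<and>
     (\<forall>y. norm (h y) \<le> M / (1 + y\<^sup>2) \<and> norm (h' y) \<le> M / (1 + y\<^sup>2) \<and> norm (h'' y) \<le> M / (1 + y\<^sup>2)))"

text \<open>
  The inverse transform \<open>g\<close> of \<open>h\<close> is bounded, and so is \<open>x\<^sup>2 g(x)\<close>, the inverse transform
  of \<open>-h''\<close>. Hence \<open>g\<close> is integrable and the inversion formula applies.
\<close>

lemma wiener_smooth_decay:
  assumes "smooth_decay h M"
  shows "wiener_le h (pi * M)"
proof -
  obtain h' h'' where h: "\<And>y. (h has_vector_derivative h' y) (at y)"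
      "\<And>y. (h' has_vector_derivative h'' y) (at y)" "continuous_on UNIV h''"
    and b: "\<And>y. norm (h y) \<le> M / (1 + y\<^sup>2)" "\<And>y. norm (h' y) \<le> M / (1 + y\<^sup>2)"
      "\<And>y. norm (h'' y) \<le> M / (1 + y\<^sup>2)"
    using assms unfolding smooth_decay_def by blast
  have cont: "continuous_on UNIV h" "continuous_on UNIV h'"
    using h by (meson continuous_at_imp_continuous_on has_vector_derivative_continuous)+
  have int: "integrable lborel h" "integrable lborel h''"
    using cont h(3) b by (auto intro: integrable_if_quadratic_decay)
  have M: "M \<ge> 0"
    using order_trans [OF norm_ge_zero b(1) [of 0]] by simp
  have L1: "(LINT x|lborel. norm (k x)) \<le> M * pi"
    if "continuous_on UNIV k" "\<And>y. norm (k y) \<le> M / (1 + y\<^sup>2)" for k :: "real \<Rightarrow> complex"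
    unfolding integral_quadratic_decay [symmetric]
    using that integrable_if_quadratic_decay [OF that]
    by (intro integral_mono integrable_quadratic_decay) auto
  have bound: "norm (fourier h (- x)) \<le> 2 * pi * M / (1 + x\<^sup>2)" for x
  proof -
    have "fourier h'' (- x) = - (x\<^sup>2) * fourier h (- x)"
      by (simp add: fourier_derivative [OF h(2,3) b(2,3)] fourier_derivative [OF h(1) cont(2) b(1,2)]
          power2_eq_square algebra_simps)
    then have "x\<^sup>2 * norm (fourier h (- x)) = norm (fourier h'' (- x))"
      by (simp add: norm_mult norm_power)
    then have "(1 + x\<^sup>2) * norm (fourier h (- x)) = norm (fourier h (- x)) + norm (fourier h'' (- x))"
      by (simp add: distrib_right)
    also have "\<dots> \<le> M * pi + M * pi"
      using L1 [OF cont(1) b(1)] L1 [OF h(3) b(3)]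
        norm_fourier_le [OF int(1), of "-x"] norm_fourier_le [OF int(2), of "-x"]
      by linarith
    finally show ?thesis
      by (simp add: field_simps add_pos_nonneg)
  qed
  have "continuous_on UNIV (\<lambda>x. fourier h (- x))"
    by (rule continuous_on_compose2 [OF continuous_on_fourier [OF int(1), of UNIV]])
      (auto intro: continuous_intros)
  with bound have g: "integrable lborel (\<lambda>x. fourier h (- x))"
    by (rule integrable_if_quadratic_decay [rotated])
  have inv: "fourier (\<lambda>x. fourier h (- x)) y = 2 * pi * h y" for y
  proof (rule fourier_inversion [OF cont(1) int(1) _ g])
    fix t
    have "M / (1 + t\<^sup>2) \<le> M / 1"
      using M by (intro divide_left_mono) (auto simp: add_pos_nonneg)
    then show "norm (h t) \<le> M"
      using b(1) [of t] by linarith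
  qed
  show ?thesis
  proof (rule wiener_leI [where g = "\<lambda>x. fourier h (- x) / (2 * pi)"])
    show "fourier (\<lambda>x. fourier h (- x) / (2 * pi)) y = h y" for y
      using inv [of y] by (simp add: fourier_def)
    have "(LINT x|lborel. norm (fourier h (- x) / (2 * pi))) = (LINT x|lborel. norm (fourier h (- x))) / (2 * pi)"
      by (simp add: norm_divide)
    also have "\<dots> \<le> (LINT x|lborel. 2 * pi * M / (1 + x\<^sup>2)) / (2 * pi)"
      using bound g by (intro divide_right_mono integral_mono integrable_quadratic_decay) auto
    also have "\<dots> = pi * M"
      by (simp only: integral_quadratic_decay) simp
    finally show "(LINT x|lborel. norm (fourier h (- x) / (2 * pi))) \<le> pi * M" .
  qed (use g in auto)
qed

section \<open>Density of smooth transforms\<close>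

lemma smooth_decay_add:
  assumes "smooth_decay f M" "smooth_decay g N"
  shows "smooth_decay (\<lambda>y. f y + g y) (M + N)"
proof -
  obtain f' f'' where f: "\<And>y. (f has_vector_derivative f' y) (at y)"
      "\<And>y. (f' has_vector_derivative f'' y) (at y)" "continuous_on UNIV f''"
    and fb: "\<And>y. norm (f y) \<le> M / (1 + y\<^sup>2) \<and> norm (f' y) \<le> M / (1 + y\<^sup>2) \<and> norm (f'' y) \<le> M / (1 + y\<^sup>2)"
    using assms(1) unfolding smooth_decay_def by blast
  obtain g' g'' where g: "\<And>y. (g has_vector_derivative g' y) (at y)"
      "\<And>y. (g' has_vector_derivative g'' y) (at y)" "continuous_on UNIV g''"
    and gb: "\<And>y. norm (g y) \<le> N / (1 + y\<^sup>2) \<and> norm (g' y) \<le> N / (1 + y\<^sup>2) \<and> norm (g'' y) \<le> N / (1 + y\<^sup>2)"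
    using assms(2) unfolding smooth_decay_def by blast
  show ?thesis
    unfolding smooth_decay_def
    by (rule exI [of _ "\<lambda>y. f' y + g' y"], rule exI [of _ "\<lambda>y. f'' y + g'' y"])
      (use f g fb gb in \<open>auto intro!: has_vector_derivative_add continuous_intros
         norm_triangle_mono simp: add_divide_distrib\<close>)
qed

lemma smooth_decay_cmult:
  assumes "smooth_decay f M"
  shows "smooth_decay (\<lambda>y. c * f y) (norm c * M)"
proof -
  obtain f' f'' where f: "\<And>y. (f has_vector_derivative f' y) (at y)"
      "\<And>y. (f' has_vector_derivative f'' y) (at y)" "continuous_on UNIV f''"
    and fb: "\<And>y. norm (f y) \<le> M / (1 + y\<^sup>2) \<and> norm (f' y) \<le> M / (1 + y\<^sup>2) \<and> norm (f'' y) \<le> M / (1 + y\<^sup>2)"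
    using assms(1) unfolding smooth_decay_def by blast
  have "norm c * x \<le> norm c * M / (1 + y\<^sup>2)" if "x \<le> M / (1 + y\<^sup>2)" for x y
    using mult_left_mono [OF that, of "norm c"] by simp
  then show ?thesis
    unfolding smooth_decay_def
    by (intro exI [of _ "\<lambda>y. c * f' y"] exI [of _ "\<lambda>y. c * f'' y"])
      (use f fb in \<open>auto intro!: has_vector_derivative_mult_right continuous_intros simp: norm_mult\<close>)
qed

lemma smooth_decay_zero: "smooth_decay (\<lambda>y. 0) 0"
  unfolding smooth_decay_def by (intro exI [of _ "\<lambda>y. 0"]) auto

lemma norm_one_plus_ii: "norm (1 + \<i> * (of_real s * of_real y)) = sqrt (1 + (s * y)\<^sup>2)"
  by (simp add: cmod_def)

lemma one_plus_ii_nonzero: "1 + \<i> * (of_real s * of_real y) \<noteq> 0"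
  by (simp add: complex_eq_iff)

text \<open>
  Each of the two rational factors contributes decay of first order. With \<open>h\<close> the product,
  \<open>h' = h r\<close> where the logarithmic derivative \<open>r\<close> and its derivative \<open>r'\<close> are bounded, so
  \<open>h'\<close> and \<open>h'' = h (r\<^sup>2 + r')\<close> decay like \<open>h\<close>.
\<close>

lemma smooth_decay_exponential_rational:
  assumes s: "0 < s" "s \<le> 1"
  shows "\<exists>M. smooth_decay (\<lambda>y. cis (- (a * y)) * (1 / (1 + \<i> * y)) * (1 / (1 + \<i> * (s * y)))) M"
proof -
  define u :: "real \<Rightarrow> complex" where "u y = 1 / (1 + \<i> * y)" for y
  define v :: "real \<Rightarrow> complex" where "v y = 1 / (1 + \<i> * (s * y))" for y
  define h where "h y = cis (- (a * y)) * u y * v y" for y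
  define r where "r y = - \<i> * a - \<i> * u y - \<i> * s * v y" for y
  define r' where "r' y = - (u y)\<^sup>2 - s\<^sup>2 * (v y)\<^sup>2" for y
  have nz: "1 + \<i> * complex_of_real y \<noteq> 0" "1 + \<i> * (complex_of_real s * complex_of_real y) \<noteq> 0" for y
    using one_plus_ii_nonzero [of 1 y] one_plus_ii_nonzero [of s y] by simp_all
  have du: "(u has_vector_derivative - \<i> * (u y)\<^sup>2) (at y)" for y
  proof -
    have "((\<lambda>z. 1 / (1 + \<i> * z)) has_field_derivative - \<i> * (u y)\<^sup>2) (at (of_real y))"
      using nz [of y] by (auto intro!: derivative_eq_intros simp: u_def power2_eq_square field_simps)
    from has_vector_derivative_real_field [OF this] show ?thesis
      by (simp add: u_def [abs_def])
  qed
  have dv: "(v has_vector_derivative - \<i> * s * (v y)\<^sup>2) (at y)" for y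
  proof -
    have "((\<lambda>z. 1 / (1 + \<i> * (s * z))) has_field_derivative - \<i> * s * (v y)\<^sup>2) (at (of_real y))"
      using nz [of y] by (auto intro!: derivative_eq_intros simp: v_def power2_eq_square field_simps)
    from has_vector_derivative_real_field [OF this] show ?thesis
      by (simp add: v_def [abs_def])
  qed
  have dc: "((\<lambda>y. cis (- (a * y))) has_vector_derivative - \<i> * a * cis (- (a * y))) (at y)" for y
    using has_vector_derivative_cis_linear [of a y] by (simp add: mult.commute)
  have dh: "(h has_vector_derivative h y * r y) (at y)" for y
    unfolding h_def [abs_def] r_def
    by (rule has_vector_derivative_eq_rhs
        [OF has_vector_derivative_mult [OF has_vector_derivative_mult [OF dc du] dv]])
      (simp add: algebra_simps power2_eq_square)
  have dr: "(r has_vector_derivative r' y) (at y)" for y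
    unfolding r_def [abs_def] r'_def
    by (rule has_vector_derivative_eq_rhs
        [OF has_vector_derivative_diff [OF has_vector_derivative_diff
            [OF has_vector_derivative_const has_vector_derivative_mult_right [OF du]]
            has_vector_derivative_mult_right [OF dv]]])
      (simp add: algebra_simps power2_eq_square)
  have cont: "continuous_on UNIV u" "continuous_on UNIV v" "continuous_on UNIV h" "continuous_on UNIV r"
    using du dv dh dr by (meson continuous_at_imp_continuous_on has_vector_derivative_continuous)+
  have u: "norm (u y) = 1 / sqrt (1 + y\<^sup>2)" for y
    using norm_one_plus_ii [of 1 y] by (simp add: u_def norm_divide)
  have v: "norm (v y) = 1 / sqrt (1 + (s * y)\<^sup>2)" for y
    using norm_one_plus_ii [of s y] by (simp add: v_def norm_divide)
  have uv1: "norm (u y) \<le> 1" "norm (v y) \<le> 1" for y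
    unfolding u v by (auto simp: divide_le_eq_1 add_pos_nonneg)
  have hb: "norm (h y) \<le> (1 / s) / (1 + y\<^sup>2)" for y
  proof -
    have "s * sqrt (1 + y\<^sup>2) = sqrt (s\<^sup>2 * (1 + y\<^sup>2))"
      using s by (simp add: real_sqrt_mult)
    also have "\<dots> \<le> sqrt (1 + (s * y)\<^sup>2)"
      using s by (auto simp: power_mult_distrib distrib_left power_le_one)
    finally have "norm (v y) \<le> 1 / (s * sqrt (1 + y\<^sup>2))"
      using s by (auto simp: v intro!: divide_left_mono mult_pos_pos add_pos_nonneg)
    then have "norm (u y) * norm (v y) \<le> norm (u y) * (1 / (s * sqrt (1 + y\<^sup>2)))"
      by (intro mult_left_mono) auto
    also have "\<dots> = (1 / s) / (1 + y\<^sup>2)"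
      using s by (simp add: u field_simps)
    finally show ?thesis
      by (simp add: h_def norm_mult)
  qed
  define R where "R = \<bar>a\<bar> + 2"
  have rb: "norm (r y) \<le> R" for y
  proof -
    have "norm (r y) \<le> norm (\<i> * complex_of_real a) + norm (\<i> * u y) + norm (\<i> * s * v y)"
      unfolding r_def by (metis (no_types, opaque_lifting) norm_triangle_le_diff norm_triangle_ineq4
          norm_minus_cancel mult_minus_left add_right_mono order_trans)
    also have "\<dots> \<le> \<bar>a\<bar> + 1 + 1 * 1"
      using uv1 [of y] s unfolding norm_mult by (intro add_mono mult_mono) auto
    finally show ?thesis
      by (simp add: R_def)
  qed
  have rb': "norm (r' y) \<le> 2" for y
  proof -
    have "norm (r' y) \<le> norm ((u y)\<^sup>2) + norm (complex_of_real (s\<^sup>2) * (v y)\<^sup>2)"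
      unfolding r'_def using norm_triangle_ineq4 [of "- (u y)\<^sup>2"] by (metis norm_minus_cancel)
    also have "\<dots> \<le> 1 + 1 * 1"
      using uv1 [of y] s unfolding norm_mult norm_power
      by (intro add_mono mult_mono power_le_one) (auto simp: power_le_one norm_power)
    finally show ?thesis by simp
  qed
  let ?M = "(1 / s) * (R\<^sup>2 + 2)"
  have R: "2 \<le> R"
    by (simp add: R_def)
  have "1 \<le> R\<^sup>2 + 2" "R \<le> R\<^sup>2 + 2"
    using R self_le_power [of R 2] by auto
  have main: "norm (h y * t) \<le> ?M / (1 + y\<^sup>2)" if "norm t \<le> R\<^sup>2 + 2" for t y
  proof -
    have "norm (h y * t) \<le> (1 / s) / (1 + y\<^sup>2) * (R\<^sup>2 + 2)"
      unfolding norm_mult using hb [of y] that s by (intro mult_mono) auto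
    then show ?thesis by simp
  qed
  have "smooth_decay h ?M"
    unfolding smooth_decay_def
  proof (intro exI conjI allI)
    fix y
    show "(h has_vector_derivative h y * r y) (at y)"
      by (rule dh)
    show "((\<lambda>y. h y * r y) has_vector_derivative h y * ((r y)\<^sup>2 + r' y)) (at y)"
      by (rule has_vector_derivative_eq_rhs [OF has_vector_derivative_mult [OF dh dr]])
        (simp add: algebra_simps power2_eq_square)
    show "norm (h y) \<le> ?M / (1 + y\<^sup>2)"
      using main [of 1 y] \<open>1 \<le> R\<^sup>2 + 2\<close> by simp
    show "norm (h y * r y) \<le> ?M / (1 + y\<^sup>2)"
      using rb [of y] \<open>R \<le> R\<^sup>2 + 2\<close> by (intro main) simp
    have "norm ((r y)\<^sup>2 + r' y) \<le> R\<^sup>2 + 2"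
      using rb [of y] rb' [of y]
      by (intro norm_triangle_mono) (simp_all add: norm_power power_mono)
    then show "norm (h y * ((r y)\<^sup>2 + r' y)) \<le> ?M / (1 + y\<^sup>2)"
      by (rule main)
  next
    show "continuous_on UNIV (\<lambda>y. h y * ((r y)\<^sup>2 + r' y))"
      unfolding r'_def by (intro continuous_intros cont)
  qed
  then show ?thesis
    unfolding h_def [abs_def] u_def v_def by blast
qed

definition one_sided_exp :: "real \<Rightarrow> real \<Rightarrow> complex" where
  "one_sided_exp s x = of_real (indicator {0<..} x * exp (- (x / s)))"

lemma integrable_one_sided_exp:
  assumes "0 < s"
  shows "integrable lborel (one_sided_exp s)"
  using integrable_I0i_exp_mscale [of "1 / s"] assms
  unfolding one_sided_exp_def [abs_def] by (intro integrable_of_real) (simp add: set_integrable_def)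

lemma norm_one_sided_exp:
  assumes "0 < s"
  shows "(LINT x|lborel. norm (one_sided_exp s x)) = s"
  using LBINT_I0i_exp_mscale [of "1 / s"] assms
  by (simp add: one_sided_exp_def interval_lebesgue_integral_0_infty set_lebesgue_integral_def norm_mult)

lemma fourier_one_sided_exp:
  assumes s: "0 < s"
  shows "fourier (one_sided_exp s) y = s * (1 / (1 + \<i> * (s * y)))"
proof -
  define k where "k = 1 / s + \<i> * y"
  have ks: "k * s = 1 + \<i> * (s * y)"
    using s by (simp add: k_def distrib_right)
  then have k: "k \<noteq> 0"
    using one_plus_ii_nonzero [of s y] by auto
  let ?f = "\<lambda>x. exp (- (x / s)) * cis (- (x * y))"
  let ?F = "\<lambda>x. - (exp (- (x / s)) * cis (- (x * y)) / k)"
  have eq: "indicator {0<..} x *\<^sub>R ?f x = one_sided_exp s x * cis (- (x * y))" for x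
    by (simp add: one_sided_exp_def split: split_indicator)
  have s0: "s \<noteq> 0" using s by simp
  have cont: "continuous_on UNIV ?f" "continuous_on UNIV ?F"
    by (intro continuous_intros; simp add: s0 k)+
  have "(LBINT x=0..\<infinity>. ?f x) = 0 - ?F 0"
  proof (rule interval_integral_FTC_integrable)
    fix x
    have "((\<lambda>x. of_real (exp (- (x / s)))) has_vector_derivative of_real (- (1 / s) * exp (- (x / s)))) (at x)"
      by (intro has_vector_derivative_of_real) (use s in \<open>auto intro!: derivative_eq_intros\<close>)
    from has_vector_derivative_mult [OF this has_vector_derivative_cis_linear [of y x]]
    have "((\<lambda>x. - (1 / k) * (of_real (exp (- (x / s))) * cis (- (x * y)))) has_vector_derivative
        - (1 / k) * (- k * (of_real (exp (- (x / s))) * cis (- (x * y))))) (at x)"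
      by (intro has_vector_derivative_mult_right) 
        (auto elim!: has_vector_derivative_eq_rhs simp: k_def algebra_simps)
    then show "(?F has_vector_derivative ?f x) (at x)"
      using k by simp
    show "isCont ?f x"
      using cont(1) by (simp add: continuous_on_eq_continuous_at)
  next
    have "set_integrable lborel {0<..} ?f"
      unfolding set_integrable_def eq by (rule integrable_fourier [OF integrable_one_sided_exp [OF s]])
    then show "set_integrable lborel (einterval 0 \<infinity>) ?f"
      by (simp add: zero_ereal_def)
    have "isCont ?F 0"
      using cont(2) by (simp add: continuous_on_eq_continuous_at)
    then show "((?F \<circ> real_of_ereal) \<longlongrightarrow> ?F 0) (at_right 0)"
      unfolding zero_ereal_def ereal_tendsto_simps isCont_def by (rule tendsto_within_subset) auto
    have "((\<lambda>x. exp (- (x / s)) / norm k) \<longlongrightarrow> 0) at_top"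
      using s k by real_asymp
    then show "((?F \<circ> real_of_ereal) \<longlongrightarrow> 0) (at_left \<infinity>)"
      unfolding ereal_tendsto_simps
      by (rule Lim_null_comparison [rotated]) (auto simp: norm_mult norm_divide)
  qed auto
  also have "(LBINT x=0..\<infinity>. ?f x) = fourier (one_sided_exp s) y"
    unfolding interval_lebesgue_integral_0_infty set_lebesgue_integral_def eq fourier_def ..
  finally have "fourier (one_sided_exp s) y = 1 / k"
    by simp
  also have "\<dots> = s * (1 / (1 + \<i> * (s * y)))"
    unfolding ks [symmetric] using k s by simp
  finally show ?thesis by simp
qed

lemma wiener_resolvent:
  assumes "0 < s"
  shows "wiener_le (\<lambda>y. s * (1 / (1 + \<i> * (s * y)))) s"
  using assms by (intro wiener_leI [where g = "one_sided_exp s"])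
    (auto simp: integrable_one_sided_exp fourier_one_sided_exp norm_one_sided_exp)


text \<open>
  Density is stated for the transforms. An approximating \<open>h\<close> then needs no explicit preimage.
\<close>

definition approximable :: "(real \<Rightarrow> complex) \<Rightarrow> bool" where
  "approximable f \<longleftrightarrow> integrable lborel f \<and>
     (\<forall>\<epsilon>>0. \<exists>h M. smooth_decay h M \<and> wiener_le (\<lambda>y. fourier f y - h y) \<epsilon>)"

lemma approximable_integrable: "approximable f \<Longrightarrow> integrable lborel f"
  by (simp add: approximable_def)

lemma approximable_zero: "approximable (\<lambda>x. 0)"
  unfolding approximable_def
proof (intro conjI allI impI)
  fix \<epsilon> :: real assume "0 < \<epsilon>"
  then have "wiener_le (\<lambda>y. fourier (\<lambda>x. 0) y - 0) \<epsilon>"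
    by (intro wiener_leI [where g = "\<lambda>x. 0"]) auto
  then show "\<exists>h M. smooth_decay h M \<and> wiener_le (\<lambda>y. fourier (\<lambda>x. 0) y - h y) \<epsilon>"
    using smooth_decay_zero by blast
qed simp

lemma approximable_add:
  assumes "approximable f" "approximable g"
  shows "approximable (\<lambda>x. f x + g x)"
  unfolding approximable_def
proof (intro conjI allI impI)
  have int: "integrable lborel f" "integrable lborel g"
    using assms by (auto simp: approximable_def)
  then show "integrable lborel (\<lambda>x. f x + g x)"
    by simp
  fix \<epsilon> :: real assume "0 < \<epsilon>"
  then have "0 < \<epsilon> / 2" by simp
  then obtain h M k N where h: "smooth_decay h M" "wiener_le (\<lambda>y. fourier f y - h y) (\<epsilon> / 2)"
    and k: "smooth_decay k N" "wiener_le (\<lambda>y. fourier g y - k y) (\<epsilon> / 2)"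
    using assms unfolding approximable_def by metis
  have "wiener_le (\<lambda>y. fourier (\<lambda>x. f x + g x) y - (h y + k y)) \<epsilon>"
    using wiener_add [OF h(2) k(2)] by (simp add: fourier_add [OF int] algebra_simps)
  then show "\<exists>h M. smooth_decay h M \<and> wiener_le (\<lambda>y. fourier (\<lambda>x. f x + g x) y - h y) \<epsilon>"
    using smooth_decay_add [OF h(1) k(1)] by blast
qed

lemma approximable_cmult:
  assumes "approximable f"
  shows "approximable (\<lambda>x. c * f x)"
proof (cases "c = 0")
  case True
  then show ?thesis using approximable_zero by simp
next
  case False
  show ?thesis
    unfolding approximable_def
  proof (intro conjI allI impI)
    show "integrable lborel (\<lambda>x. c * f x)"
      using assms by (simp add: approximable_def)
    fix \<epsilon> :: real assume "0 < \<epsilon>"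
    with False have "0 < \<epsilon> / norm c" by simp
    then obtain h M where h: "smooth_decay h M" "wiener_le (\<lambda>y. fourier f y - h y) (\<epsilon> / norm c)"
      using assms unfolding approximable_def by metis
    have "wiener_le (\<lambda>y. fourier (\<lambda>x. c * f x) y - c * h y) \<epsilon>"
      using wiener_cmult [OF h(2), of c] False by (simp add: fourier_cmult right_diff_distrib)
    then show "\<exists>h M. smooth_decay h M \<and> wiener_le (\<lambda>y. fourier (\<lambda>x. c * f x) y - h y) \<epsilon>"
      using smooth_decay_cmult [OF h(1)] by blast
  qed
qed

lemma approximable_diff: "approximable f \<Longrightarrow> approximable g \<Longrightarrow> approximable (\<lambda>x. f x - g x)"
  using approximable_add [OF _ approximable_cmult [of g "-1"], of f] by simp

text \<open>
  Dominated convergence turns pointwise limits into limits in \<open>L\<^sub>1\<close>, and approximability is closed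
  under the latter.
\<close>

lemma approximable_dominated_limit:
  assumes s: "\<And>i. approximable (s i)" and lim: "\<And>x. (\<lambda>i. s i x) \<longlonglongrightarrow> f x"
    and dom: "\<And>i x. norm (s i x) \<le> w x" "integrable lborel w"
  shows "approximable f"
proof -
  have int: "integrable lborel (s i)" for i
    using s by (simp add: approximable_def)
  then have [measurable]: "s i \<in> borel_measurable borel" for i
    by auto
  have [measurable]: "f \<in> borel_measurable borel"
    by (rule borel_measurable_LIMSEQ_metric [OF _ lim]) simp
  have fw: "norm (f x) \<le> w x" for x
    by (rule LIMSEQ_le_const2 [OF tendsto_norm [OF lim]]) (use dom(1) in auto)
  have f: "integrable lborel f"
    by (rule Bochner_Integration.integrable_bound [OF dom(2)]) (use fw in \<open>auto intro: order_trans abs_ge_self\<close>)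
  have "(\<lambda>i. LINT x|lborel. norm (f x - s i x)) \<longlonglongrightarrow> (LINT x::real|lborel. 0)"
  proof (rule integral_dominated_convergence [where w = "\<lambda>x. 2 * w x"])
    show "AE x in lborel. (\<lambda>i. norm (f x - s i x)) \<longlonglongrightarrow> 0"
    proof (intro AE_I2)
      fix x
      have "(\<lambda>i. norm (f x - s i x)) \<longlonglongrightarrow> norm (f x - f x)"
        by (intro tendsto_intros lim)
      then show "(\<lambda>i. norm (f x - s i x)) \<longlonglongrightarrow> 0" by simp
    qed
    show "AE x in lborel. norm (norm (f x - s i x)) \<le> 2 * w x" for i
    proof (intro AE_I2)
      fix x
      show "norm (norm (f x - s i x)) \<le> 2 * w x"
        using norm_triangle_ineq4 [of "f x" "s i x"] fw [of x] dom(1) [of i x] by simp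
    qed
  qed (use dom(2) in auto)
  then have lim0: "(\<lambda>i. LINT x|lborel. norm (f x - s i x)) \<longlonglongrightarrow> 0"
    by simp
  show ?thesis
    unfolding approximable_def
  proof (intro conjI allI impI f)
    fix \<epsilon> :: real assume \<epsilon>: "0 < \<epsilon>"
    then obtain i where "(LINT x|lborel. norm (f x - s i x)) < \<epsilon> / 2"
      using order_tendstoD(2) [OF lim0, of "\<epsilon> / 2"] by (auto simp: eventually_sequentially)
    then have w1: "wiener_le (fourier (\<lambda>x. f x - s i x)) (\<epsilon> / 2)"
      using wiener_mono [OF wiener_fourier, of "\<lambda>x. f x - s i x"] f int by simp
    have "0 < \<epsilon> / 2" using \<epsilon> by simp
    then obtain h M where h: "smooth_decay h M" "wiener_le (\<lambda>y. fourier (s i) y - h y) (\<epsilon> / 2)"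
      using s unfolding approximable_def by metis
    have "fourier f y = fourier (\<lambda>x. f x - s i x) y + fourier (s i) y" for y
      using fourier_add [of "\<lambda>x. f x - s i x" "s i"] f int by simp
    then have "wiener_le (\<lambda>y. fourier f y - h y) \<epsilon>"
      using wiener_add [OF w1 h(2)] by (simp add: algebra_simps)
    then show "\<exists>h M. smooth_decay h M \<and> wiener_le (\<lambda>y. fourier f y - h y) \<epsilon>"
      using h(1) by blast
  qed
qed

text \<open>
  Dividing the transform by \<open>1 + \<i>sy\<close> changes it by
  \<open>exp(-\<i>ay) (1 - 1/(1 + \<i>y)) s/(1 + \<i>sy)\<close>, whose norm is at most \<open>2s\<close> since \<open>s/(1 + \<i>sy)\<close>
  is the transform of a one-sided exponential with integral \<open>s\<close>.
\<close>

lemma approximable_translated_exp: "approximable (\<lambda>x. one_sided_exp 1 (x - a))"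
  unfolding approximable_def
proof (intro conjI allI impI)
  show "integrable lborel (\<lambda>x. one_sided_exp 1 (x - a))"
    using lborel_integrable_real_affine [OF integrable_one_sided_exp [of 1], of 1 "-a"] by simp
  fix \<epsilon> :: real assume \<epsilon>: "0 < \<epsilon>"
  define s where "s = min 1 (\<epsilon> / 2)"
  have s: "0 < s" "s \<le> 1" "2 * s \<le> \<epsilon>"
    using \<epsilon> by (auto simp: s_def)
  let ?u = "\<lambda>y::real. 1 / (1 + \<i> * y)" and ?v = "\<lambda>y::real. 1 / (1 + \<i> * (s * y))"
  obtain M where M: "smooth_decay (\<lambda>y. cis (- (a * y)) * ?u y * ?v y) M"
    using smooth_decay_exponential_rational [OF s(1,2)] by blast
  have u: "wiener_le ?u 1"
    using wiener_resolvent [of 1] by simp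
  have v: "wiener_le (\<lambda>y. s * ?v y) s"
    using wiener_resolvent [OF s(1)] .
  have "wiener_le (\<lambda>y. cis (- (a * y)) * (s * ?v y - ?u y * (s * ?v y))) (s + 1 * s)"
    by (intro wiener_modulation wiener_diff wiener_mult u v)
  moreover have "cis (- (a * y)) * (s * ?v y - ?u y * (s * ?v y))
      = fourier (\<lambda>x. one_sided_exp 1 (x - a)) y - cis (- (a * y)) * ?u y * ?v y" for y
  proof -
    have nz: "1 + \<i> * complex_of_real y \<noteq> 0" "1 + \<i> * (complex_of_real s * complex_of_real y) \<noteq> 0"
      using one_plus_ii_nonzero [of 1 y] one_plus_ii_nonzero [of s y] by simp_all
    have "s * ?v y - ?u y * (s * ?v y) = ?u y - ?u y * ?v y"
      using nz by (simp add: divide_simps) (simp add: algebra_simps)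
    then show ?thesis
      by (simp only: fourier_translate fourier_one_sided_exp [OF zero_less_one])
        (simp add: algebra_simps)
  qed
  ultimately have "wiener_le (\<lambda>y. fourier (\<lambda>x. one_sided_exp 1 (x - a)) y - cis (- (a * y)) * ?u y * ?v y) (s + 1 * s)"
    by simp
  then have "wiener_le (\<lambda>y. fourier (\<lambda>x. one_sided_exp 1 (x - a)) y - cis (- (a * y)) * ?u y * ?v y) \<epsilon>"
    using s(3) by (elim wiener_mono) simp
  then show "\<exists>h M. smooth_decay h M \<and> wiener_le (\<lambda>y. fourier (\<lambda>x. one_sided_exp 1 (x - a)) y - h y) \<epsilon>"
    using M by blast
qed

lemma approximable_exp_half_line: "approximable (\<lambda>x. of_real (exp (- x) * indicator {a<..} x))"
proof -
  have "of_real (exp (- x) * indicator {a<..} x) = of_real (exp (- a)) * one_sided_exp 1 (x - a)" for x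
    by (simp add: one_sided_exp_def exp_diff exp_minus inverse_eq_divide split: split_indicator)
  then show ?thesis
    by (simp only: approximable_cmult approximable_translated_exp)
qed

text \<open>
  On an interval the exponential is exactly a combination of two one-sided exponentials. This is why
  indicators carry the weight \<open>exp(-x)\<close> in the density argument.
\<close>

lemma approximable_exp_Ioc: "approximable (\<lambda>x. of_real (exp (- x) * indicator {a<..b} x))"
proof (cases "a \<le> b")
  case True
  then have "of_real (exp (- x) * indicator {a<..b} x) =
    complex_of_real (exp (- x) * indicator {a<..} x) - of_real (exp (- x) * indicator {b<..} x)" for x
    by (auto split: split_indicator)
  then show ?thesis
    by (simp only: approximable_diff approximable_exp_half_line)
qed (simp add: approximable_zero)

text \<open>
  A Dynkin system argument starting from half-open intervals. Cutting off at \<open>a\<close> keeps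
  \<open>exp(-x)\<close> integrable, as complements and limits of unions demand.
\<close>

lemma approximable_exp_borel:
  assumes "B \<in> sets borel"
  shows "approximable (\<lambda>x. of_real (exp (- x) * indicator (B \<inter> {a<..}) x))"
proof -
  let ?G = "range (\<lambda>(a, b). {a<..b::real})"
  have B: "B \<in> sigma_sets UNIV ?G"
    using assms unfolding borel_sigma_sets_Ioc by (simp add: sets_measure_of)
  have "Int_stable ?G"
    by (auto simp: Int_stable_def Int_greaterThanAtMost)
  moreover have "?G \<subseteq> Pow UNIV" by simp
  ultimately show ?thesis
    using B
  proof (induction rule: sigma_sets_induct_disjoint)
    case (basic A)
    then obtain c b where A: "A = {c<..b}" by auto
    have "A \<inter> {a<..} = {max c a<..b}" by (auto simp: A)
    then show ?case by (simp only: approximable_exp_Ioc)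
  next
    case empty
    show ?case by (simp add: approximable_zero)
  next
    case (compl A)
    have "of_real (exp (- x) * indicator ((UNIV - A) \<inter> {a<..}) x) =
      complex_of_real (exp (- x) * indicator {a<..} x) - of_real (exp (- x) * indicator (A \<inter> {a<..}) x)" for x
      by (auto split: split_indicator)
    then show ?case
      using compl.IH by (simp only: approximable_diff approximable_exp_half_line)
  next
    case (union A)
    show ?case
    proof (rule approximable_dominated_limit)
      have ind: "indicator ((\<Union>i<n. A i) \<inter> {a<..}) x = (\<Sum>i<n. indicator (A i \<inter> {a<..}) x :: real)" for n x
      proof -
        have "indicator ((\<Union>i<n. A i) \<inter> {a<..}) x = (indicator (\<Union>i<n. A i) x * indicator {a<..} x :: real)"
          by (simp add: indicator_inter_arith)
        also have "\<dots> = (\<Sum>i<n. indicator (A i) x) * indicator {a<..} x"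
          using union.hyps(1) by (subst indicator_UN_disjoint)
            (auto simp: disjoint_family_on_def)
        finally show ?thesis
          by (simp add: sum_distrib_right indicator_inter_arith)
      qed
      show "approximable (\<lambda>x. of_real (exp (- x) * indicator ((\<Union>i<n. A i) \<inter> {a<..}) x))" for n
      proof -
        have "approximable (\<lambda>x. \<Sum>i<n. of_real (exp (- x) * indicator (A i \<inter> {a<..}) x))"
          using union.IH by (induction n) (simp_all add: approximable_zero approximable_add)
        then show ?thesis
          by (simp only: ind sum_distrib_left of_real_sum)
      qed
      show "(\<lambda>n. complex_of_real (exp (- x) * indicator ((\<Union>i<n. A i) \<inter> {a<..}) x))
          \<longlonglongrightarrow> of_real (exp (- x) * indicator ((\<Union>i. A i) \<inter> {a<..}) x)" for x
        unfolding indicator_inter_arith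
        by (intro tendsto_of_real tendsto_mult tendsto_const LIMSEQ_indicator_UN)
      show "norm (complex_of_real (exp (- x) * indicator ((\<Union>i<n. A i) \<inter> {a<..}) x))
          \<le> exp (- x) * indicator {a<..} x" for n x
        by (auto split: split_indicator)
      show "integrable lborel (\<lambda>x. exp (- x) * indicator {a<..} x)"
        using integrable_Re [OF approximable_integrable [OF approximable_exp_half_line [of a]]]
        by simp
    qed
  qed
qed

text \<open>
  Measure-theoretic induction for \<open>exp(x) f(x)\<close>, which is integrable for the measure with density
  \<open>exp(-x)\<close>.
\<close>

theorem integrable_approximable:
  assumes f: "integrable lborel f"
  shows "approximable f"
proof -
  define M where "M = density lborel (\<lambda>x::real. ennreal (exp (- x)))"
  have M: "integrable M g \<longleftrightarrow> integrable lborel (\<lambda>x. exp (- x) *\<^sub>R g x)"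
    if "g \<in> borel_measurable borel" for g :: "real \<Rightarrow> complex"
    unfolding M_def using that by (subst integrable_density) auto
  have sets_M [simp]: "sets M = sets borel" "space M = UNIV"
    by (simp_all add: M_def)
  have [measurable]: "f \<in> borel_measurable borel"
    using f by auto
  have "integrable M (\<lambda>x. exp x *\<^sub>R f x)"
    using f by (simp add: M exp_minus)
  then have "approximable (\<lambda>x. exp (- x) *\<^sub>R (exp x *\<^sub>R f x))"
  proof (induction rule: integrable_induct)
    case (base A c)
    show ?case
    proof (rule approximable_dominated_limit)
      show "approximable (\<lambda>x. c * of_real (exp (- x) * indicator (A \<inter> {- real n<..}) x))" for n
        using base(1) by (intro approximable_cmult approximable_exp_borel) simp
      show "(\<lambda>n. c * of_real (exp (- x) * indicator (A \<inter> {- real n<..}) x))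
        \<longlonglongrightarrow> exp (- x) *\<^sub>R (indicator A x *\<^sub>R c)" for x
      proof (rule tendsto_eventually)
        obtain N where "- x < real N" using reals_Archimedean2 by blast
        then have "- real n < x" if "n \<ge> N" for n
          using that by linarith
        then show "\<forall>\<^sub>F n in sequentially. c * of_real (exp (- x) * indicator (A \<inter> {- real n<..}) x)
            = exp (- x) *\<^sub>R (indicator A x *\<^sub>R c)"
          by (auto simp: eventually_sequentially scaleR_conv_of_real split: split_indicator intro!: exI [of _ N])
      qed
      show "norm (c * of_real (exp (- x) * indicator (A \<inter> {- real n<..}) x))
          \<le> norm (exp (- x) *\<^sub>R (indicator A x *\<^sub>R c))" for n x
        by (auto simp: norm_mult split: split_indicator)
      have "integrable M (\<lambda>x. indicator A x *\<^sub>R c)"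
        using base by (intro integrable_scaleR_left integrable_real_indicator) auto
      then have "integrable lborel (\<lambda>x. exp (- x) *\<^sub>R (indicator A x *\<^sub>R c))"
        using base(1) by (subst (asm) M) auto
      then show "integrable lborel (\<lambda>x. norm (exp (- x) *\<^sub>R (indicator A x *\<^sub>R c)))"
        by (rule integrable_norm)
    qed
  next
    case (add f g)
    then show ?case by (simp only: scaleR_add_right approximable_add)
  next
    case (lim f s)
    have f: "f \<in> borel_measurable borel"
      using lim.hyps(4) by (auto simp: M_def dest: borel_measurable_integrable)
    show ?case
    proof (rule approximable_dominated_limit)
      show "(\<lambda>i. exp (- x) *\<^sub>R s i x) \<longlonglongrightarrow> exp (- x) *\<^sub>R f x" for x
        using lim.hyps(2) by (intro tendsto_intros) simp
      show "norm (exp (- x) *\<^sub>R s i x) \<le> 2 * norm (exp (- x) *\<^sub>R f x)" for i x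
        using lim.hyps(3) [of x i] by simp
      show "integrable lborel (\<lambda>x. 2 * norm (exp (- x) *\<^sub>R f x))"
        using lim.hyps(4) M [OF f] by (intro integrable_mult_right integrable_norm) simp
    qed (use lim.IH in simp)
  qed
  then show ?thesis
    by (simp add: exp_minus)
qed

section \<open>Powers of reciprocals\<close>

lemma has_vector_derivative_inverse_power:
  fixes P :: "real \<Rightarrow> complex"
  assumes "(P has_vector_derivative P') (at y)" "P y \<noteq> 0"
  shows "((\<lambda>y. inverse (P y) ^ n) has_vector_derivative (- (of_nat n * P' * inverse (P y) ^ Suc n))) (at y)"
proof -
  have "((\<lambda>z. inverse z ^ n) has_field_derivative (- (of_nat n * inverse (P y) ^ Suc n))) (at (P y))"
    using DERIV_power [OF DERIV_inverse [OF assms(2)], of n]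
    by (cases n) (simp_all add: mult_ac)
  from field_vector_diff_chain_at [OF assms(1) this] show ?thesis
    by (simp add: o_def mult_ac)
qed

text \<open>
  The point is the growth in \<open>n\<close>: apart from a quadratic polynomial it is the geometric rate
  \<open>1/d\<close> given by the supremum of \<open>1/\<bar>1 + p\<bar>\<close>, whereas submultiplicativity of a norm would only
  give powers of the norm of the reciprocal. Every derivative of \<open>q^n\<close>, with \<open>q = 1/(1 + p)\<close>,
  costs a factor of order \<open>n\<close>, one additional factor \<open>q\<close>, and derivatives of \<open>p\<close>, which
  supply the decay.
\<close>

lemma smooth_decay_inverse_power:
  assumes p: "smooth_decay p M" and d: "0 < d" "d \<le> 1" and low: "\<And>y. d \<le> norm (1 + p y)"
  shows "smooth_decay (\<lambda>y. inverse (1 + p y) ^ n - 1) (real n * (real n + 1) * (M * (M + 1)) * (1 / d) ^ (n + 2))"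
proof -
  obtain p' p'' where der: "\<And>y. (p has_vector_derivative p' y) (at y)"
      "\<And>y. (p' has_vector_derivative p'' y) (at y)" "continuous_on UNIV p''"
    and b: "\<And>y. norm (p y) \<le> M / (1 + y\<^sup>2)" "\<And>y. norm (p' y) \<le> M / (1 + y\<^sup>2)"
      "\<And>y. norm (p'' y) \<le> M / (1 + y\<^sup>2)"
    using p unfolding smooth_decay_def by blast
  have cont: "continuous_on UNIV p" "continuous_on UNIV p'"
    using der by (meson continuous_at_imp_continuous_on has_vector_derivative_continuous)+
  have M: "M \<ge> 0"
    using order_trans [OF norm_ge_zero b(1) [of 0]] by simp
  define q where "q y = inverse (1 + p y)" for y
  define D where "D = 1 / d"
  have D: "D \<ge> 1"
    using d by (simp add: D_def)
  have nz: "1 + p y \<noteq> 0" for y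
    using low [of y] d by auto
  have q: "norm (q y) \<le> D" for y
    using le_imp_inverse_le [OF low [of y] d(1)] by (simp add: q_def D_def norm_inverse inverse_eq_divide [of d])
  have qpow: "norm (q y) ^ k \<le> D ^ m" if "k \<le> m" for k m y
    using power_mono [OF q, of y k] power_increasing [OF that D] by simp
  have dq: "((\<lambda>y. q y ^ k) has_vector_derivative (- (of_nat k * p' y * q y ^ Suc k))) (at y)" for k y
    using has_vector_derivative_inverse_power
        [OF has_vector_derivative_add [OF has_vector_derivative_const der(1)], of 1 y k] nz
    by (simp add: q_def)
  have contq: "continuous_on UNIV q"
    unfolding q_def using nz by (intro continuous_intros cont) auto
  define h' where "h' y = - (of_nat n * p' y * q y ^ Suc n)" for y
  define h'' where "h'' y = of_nat n * (of_nat n + 1) * p' y ^ 2 * q y ^ (n + 2) - of_nat n * p'' y * q y ^ Suc n" for y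
  let ?K = "real n * (real n + 1) * (M * (M + 1)) * D ^ (n + 2)"
  have K: "real n * (M * D ^ (n + 2)) \<le> ?K"
  proof -
    have "real n * (M * D ^ (n + 2)) = real n * 1 * (M * 1) * D ^ (n + 2)"
      by simp
    also have "\<dots> \<le> ?K"
      using M D by (intro mult_right_mono mult_mono) auto
    finally show ?thesis .
  qed
  have "smooth_decay (\<lambda>y. q y ^ n - 1) ?K"
    unfolding smooth_decay_def
  proof (intro exI conjI allI)
    fix y :: real
    define w where "w = 1 / (1 + y\<^sup>2)"
    have w: "0 \<le> w" "w \<le> 1"
      by (simp_all add: w_def add_pos_nonneg)
    have bw: "norm (p y) \<le> M * w" "norm (p' y) \<le> M * w" "norm (p'' y) \<le> M * w"
      using b [of y] by (simp_all add: w_def)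
    have Kw: "real n * (M * w) * D ^ (n + 2) \<le> ?K / (1 + y\<^sup>2)"
      using mult_right_mono [OF K w(1)] by (simp add: w_def)
    show "((\<lambda>y. q y ^ n - 1) has_vector_derivative h' y) (at y)"
      using has_vector_derivative_diff [OF dq [of n y] has_vector_derivative_const [of 1]]
      by (simp add: h'_def)
    show "(h' has_vector_derivative h'' y) (at y)"
    proof -
      have "((\<lambda>y. - (of_nat n * (p' y * q y ^ Suc n))) has_vector_derivative
         - (of_nat n * (p' y * (- (of_nat (Suc n) * p' y * q y ^ Suc (Suc n))) + p'' y * q y ^ Suc n))) (at y)"
        by (intro has_vector_derivative_minus has_vector_derivative_mult_right
            has_vector_derivative_mult der dq)
      then show ?thesis
        unfolding h'_def h''_def
        by (auto elim!: has_vector_derivative_eq_rhs simp: algebra_simps power2_eq_square)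
    qed
    show "norm (q y ^ n - 1) \<le> ?K / (1 + y\<^sup>2)"
    proof -
      \<comment> \<open>The decay comes from \<open>q - 1 = - p q\<close> and the geometric sum for \<open>q^n - 1\<close>.\<close>
      have "q y - 1 = - (p y * q y)"
        using nz [of y] by (simp add: q_def field_simps)
      then have "norm (q y ^ n - 1) = norm (p y) * norm (\<Sum>k<n. q y ^ Suc k)"
        by (simp add: power_diff_1_eq sum_distrib_left sum_negf mult.assoc flip: norm_mult)
      also have "\<dots> \<le> norm (p y) * (\<Sum>k<n. D ^ (n + 2))"
        by (intro mult_left_mono order_trans [OF norm_sum] sum_mono)
          (simp_all only: norm_power norm_ge_zero, rule qpow, simp)
      also have "\<dots> \<le> (M * w) * (\<Sum>k<n. D ^ (n + 2))"
        using bw D by (intro mult_right_mono) auto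
      also have "\<dots> = real n * (M * w) * D ^ (n + 2)"
        by simp
      finally show ?thesis
        using Kw by linarith
    qed
    show "norm (h' y) \<le> ?K / (1 + y\<^sup>2)"
    proof -
      have "norm (h' y) = real n * norm (p' y) * norm (q y) ^ Suc n"
        by (simp add: h'_def norm_mult norm_power)
      also have "\<dots> \<le> real n * (M * w) * D ^ (n + 2)"
        using bw M w D by (intro mult_mono qpow) auto
      finally show ?thesis
        using Kw by linarith
    qed
    show "norm (h'' y) \<le> ?K / (1 + y\<^sup>2)"
    proof -
      have n1: "norm (of_nat n + 1 :: complex) = real n + 1"
        using norm_of_nat [of "Suc n", where 'a = complex] by (simp add: add.commute)
      have "norm (h'' y) \<le> real n * (real n + 1) * (norm (p' y) * norm (p' y)) * norm (q y) ^ (n + 2)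
          + real n * norm (p'' y) * norm (q y) ^ Suc n"
        unfolding h''_def
        by (rule order_trans [OF norm_triangle_ineq4])
          (simp add: norm_mult norm_power power2_eq_square n1)
      also have "\<dots> \<le> real n * (real n + 1) * (M * (M * w)) * D ^ (n + 2)
          + real n * (M * w) * D ^ (n + 2)"
      proof (intro add_mono mult_mono qpow)
        show "norm (p' y) \<le> M"
          using bw(2) mult_left_mono [OF w(2) M] by simp
      qed (use bw M w D in auto)
      also have "\<dots> \<le> real n * (real n + 1) * (M * (M * w)) * D ^ (n + 2)
          + real n * (real n + 1) * (M * w) * D ^ (n + 2)"
        using M w D by (intro add_left_mono mult_right_mono) (auto simp: algebra_simps)
      also have "\<dots> = ?K / (1 + y\<^sup>2)"
        by (simp add: w_def algebra_simps add_divide_distrib)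
      finally show ?thesis .
    qed
  next
    show "continuous_on UNIV h''"
      unfolding h''_def by (intro continuous_intros cont contq der)
  qed
  then show ?thesis
    by (simp add: q_def D_def)
qed

section \<open>Wiener's lemma\<close>

text \<open>
  The approximating functions tend to zero at infinity, and the approximation is uniform.
\<close>

theorem Riemann_Lebesgue:
  assumes "integrable lborel f" "0 < \<epsilon>"
  obtains R where "0 \<le> R" "\<And>y. R < \<bar>y\<bar> \<Longrightarrow> norm (fourier f y) < \<epsilon>"
proof -
  obtain h M where h: "smooth_decay h M" "wiener_le (\<lambda>y. fourier f y - h y) (\<epsilon> / 2)"
    using integrable_approximable [OF assms(1)] assms(2) unfolding approximable_def
    by (meson half_gt_zero)
  have hM: "norm (h y) \<le> M / (1 + y\<^sup>2)" for y
    using h(1) unfolding smooth_decay_def by blast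
  have "norm (fourier f y) < \<epsilon>" if "max 1 (2 * M / \<epsilon>) < \<bar>y\<bar>" for y
  proof -
    have "\<bar>y\<bar> \<le> y\<^sup>2"
      using that self_le_power [of "\<bar>y\<bar>" 2] by simp
    then have "2 * M / \<epsilon> < 1 + y\<^sup>2"
      using that by linarith
    then have "M / (1 + y\<^sup>2) < \<epsilon> / 2"
      using assms(2) by (simp add: divide_less_eq less_divide_eq add_pos_nonneg mult.commute)
    moreover have "norm (fourier f y) \<le> norm (fourier f y - h y) + norm (h y)"
      by (metis diff_add_cancel norm_triangle_ineq)
    ultimately show ?thesis
      using wiener_sup_bound [OF h(2), of y] hM [of y] by linarith
  qed
  then show thesis
    by (intro that [of "max 1 (2 * M / \<epsilon>)"]) auto
qed

text \<open>
  Far out the transform is small; on the remaining compact interval a continuous function attains its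
  minimum.
\<close>

lemma fourier_bounded_away:
  assumes f: "integrable lborel f" and nz: "\<And>y. 1 + fourier f y \<noteq> 0"
  obtains \<delta> where "0 < \<delta>" "\<And>y. \<delta> \<le> norm (1 + fourier f y)"
proof -
  obtain R where R: "0 \<le> R" "\<And>y. R < \<bar>y\<bar> \<Longrightarrow> norm (fourier f y) < 1 / 2"
    using Riemann_Lebesgue [OF f, of "1 / 2"] by auto
  have "continuous_on {-R..R} (\<lambda>y. norm (1 + fourier f y))"
    by (intro continuous_intros continuous_on_fourier f)
  then have "\<exists>y0\<in>{-R..R}. \<forall>y\<in>{-R..R}. norm (1 + fourier f y0) \<le> norm (1 + fourier f y)"
    using R(1) by (intro continuous_attains_inf) auto
  then obtain y0 where y0: "\<And>y. y \<in> {-R..R} \<Longrightarrow> norm (1 + fourier f y0) \<le> norm (1 + fourier f y)"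
    by blast
  show thesis
  proof (rule that [of "min (1 / 2) (norm (1 + fourier f y0))"])
    fix y
    show "min (1 / 2) (norm (1 + fourier f y0)) \<le> norm (1 + fourier f y)"
    proof (cases "\<bar>y\<bar> \<le> R")
      case True
      then show ?thesis using y0 [of y] by (simp add: abs_le_iff)
    next
      case False
      then have "norm (fourier f y) < 1 / 2" using R(2) by simp
      moreover have "norm (1::complex) \<le> norm (1 + fourier f y) + norm (fourier f y)"
        by (metis add_diff_cancel_right' norm_triangle_ineq4)
      ultimately show ?thesis by simp
    qed
  qed (use nz in simp)
qed

text \<open>
  Newman's series. With \<open>u = h - fourier f\<close> and \<open>q = 1/(1 + h)\<close> one has \<open>\<bar>u q\<bar> \<le> 1/2\<close>, so
  \<open>fourier f * q / (1 - u q)\<close> is a geometric series with value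
  \<open>fourier f / (1 + fourier f)\<close>. Since constants are not transforms of integrable functions,
  \<open>q^(n+1)\<close> is split into \<open>q^(n+1) - 1\<close> and \<open>1\<close>, and the factor \<open>fourier f\<close> is kept.
\<close>

theorem Wiener_reciprocal:
  assumes f: "integrable lborel f" and nz: "\<And>y. 1 + fourier f y \<noteq> 0"
  obtains g where "integrable lborel g" "\<And>y. fourier g y = fourier f y / (1 + fourier f y)"
proof -
  obtain \<delta> where \<delta>: "0 < \<delta>" "\<And>y. \<delta> \<le> norm (1 + fourier f y)"
    using fourier_bounded_away [OF f nz] by blast
  define d where "d = min (1 / 2) (\<delta> / 3)"
  have d: "0 < d" "2 * d \<le> 1" "3 * d \<le> \<delta>"
    using \<delta>(1) by (auto simp: d_def)
  obtain h M where h: "smooth_decay h M" "wiener_le (\<lambda>y. fourier f y - h y) d"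
    using integrable_approximable [OF f] d(1) unfolding approximable_def by blast
  define u where "u y = h y - fourier f y" for y
  define q where "q y = inverse (1 + h y)" for y
  define c where "c = (LINT x|lborel. norm (f x))"
  have u: "wiener_le u d"
    using wiener_cmult [OF h(2), of "-1"] by (simp add: u_def [abs_def])
  have low: "2 * d \<le> norm (1 + h y)" for y
  proof -
    have "norm (1 + fourier f y) \<le> norm (1 + h y) + norm (u y)"
      using norm_triangle_ineq4 [of "1 + h y" "u y"] by (simp add: u_def)
    then show ?thesis
      using \<delta>(2) [of y] d(3) wiener_sup_bound [OF u, of y] by linarith
  qed
  define C where "C n = real (Suc n) * (real (Suc n) + 1) * (M * (M + 1)) * (1 / (2 * d)) ^ (Suc n + 2)" for n
  have q: "wiener_le (\<lambda>y. q y ^ Suc n - 1) (pi * C n)" for n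
    using smooth_decay_inverse_power [OF h(1) _ d(2) low, of "Suc n"] d(1)
    unfolding q_def C_def by (intro wiener_smooth_decay) simp
  have fu: "wiener_le (\<lambda>y. fourier f y * u y ^ n) (c * d ^ n)" for n
  proof (induction n)
    case 0
    show ?case using wiener_fourier [OF f] by (simp add: c_def)
  next
    case (Suc n)
    show ?case using wiener_mult [OF Suc u] by (simp add: mult_ac)
  qed
  have "wiener_le (\<lambda>y. fourier f y * u y ^ n * (q y ^ Suc n - 1) + fourier f y * u y ^ n)
      (c * d ^ n * (pi * C n) + c * d ^ n)" for n
    by (intro wiener_add wiener_mult fu q)
  then have terms: "wiener_le (\<lambda>y. fourier f y * u y ^ n * q y ^ Suc n) (c * d ^ n * (pi * C n) + c * d ^ n)" for n
    by (simp add: algebra_simps)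
  have "summable (\<lambda>n. c * d ^ n * (pi * C n) + c * d ^ n)"
  proof (intro summable_add)
    \<comment> \<open>The ratio is \<open>d / (2d) = 1/2\<close>, the distance of the approximation over the lower bound for \<open>1 + h\<close>.\<close>
    have "(\<lambda>n. (real n + 1) * (real n + 2) * (1 / 2) ^ n) \<in> O(\<lambda>n. (3 / 4) ^ n)"
      by real_asymp
    then have "summable (\<lambda>n. (real n + 1) * (real n + 2) * (1 / 2) ^ n)"
      by (rule summable_comparison_test_bigo [rotated]) simp
    then have "summable (\<lambda>n. (c * pi * M * (M + 1) * (1 / (2 * d)) ^ 3) * ((real n + 1) * (real n + 2) * (1 / 2) ^ n))"
      by (rule summable_mult)
    moreover have "c * d ^ n * (pi * C n) =
        (c * pi * M * (M + 1) * (1 / (2 * d)) ^ 3) * ((real n + 1) * (real n + 2) * (1 / 2) ^ n)" for n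
    proof -
      have "d ^ n * (1 / (2 * d)) ^ (Suc n + 2) = (d * (1 / (2 * d))) ^ n * (1 / (2 * d)) ^ 3"
        by (simp only: power_mult_distrib) (simp add: power_add numeral_eq_Suc)
      also have "\<dots> = (1 / 2) ^ n * (1 / (2 * d)) ^ 3"
        using d(1) by simp
      finally have "c * d ^ n * (pi * C n) =
          c * pi * (real (Suc n) * (real (Suc n) + 1)) * (M * (M + 1)) * ((1 / 2) ^ n * (1 / (2 * d)) ^ 3)"
        unfolding C_def by (simp only: mult_ac)
      then show ?thesis
        by (simp only: of_nat_Suc mult_ac) (simp add: add.commute)
    qed
    ultimately show "summable (\<lambda>n. c * d ^ n * (pi * C n))"
      by (simp only:)
    show "summable (\<lambda>n. c * d ^ n)"
      using d by (intro summable_mult summable_geometric) auto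
  qed
  from wiener_suminf [OF terms this]
  have "wiener_le (\<lambda>y. \<Sum>n. fourier f y * u y ^ n * q y ^ Suc n) (\<Sum>n. c * d ^ n * (pi * C n) + c * d ^ n)" .
  moreover have "(\<Sum>n. fourier f y * u y ^ n * q y ^ Suc n) = fourier f y / (1 + fourier f y)" for y
  proof -
    have nzh: "1 + h y \<noteq> 0"
      using low [of y] d(1) by auto
    have "norm (u y) \<le> norm (1 + h y) / 2"
      using wiener_sup_bound [OF u, of y] low [of y] by linarith
    moreover have "0 < norm (1 + h y)"
      using nzh by simp
    ultimately have "norm (u y) < norm (1 + h y)"
      by linarith
    then have "norm (u y * q y) < 1"
      using nzh by (simp add: q_def norm_divide divide_less_eq flip: divide_inverse)
    then have "(\<lambda>n. fourier f y * q y * (u y * q y) ^ n) sums (fourier f y * q y * (1 / (1 - u y * q y)))"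
      by (intro sums_mult geometric_sums)
    then have "(\<Sum>n. fourier f y * u y ^ n * q y ^ Suc n) = fourier f y * q y * (1 / (1 - u y * q y))"
      by (simp add: power_mult_distrib mult_ac sums_iff)
    also have "1 - u y * q y = (1 + fourier f y) * q y"
      using nzh by (simp add: u_def q_def field_simps)
    finally show ?thesis
      using nzh nz [of y] by (simp add: q_def)
  qed
  ultimately show thesis
    using that unfolding wiener_le_def by auto
qed

section \<open>Reduction of the Hartley transforms\<close>

text \<open>
  Fubini's theorem is applied to products of Borel measures, whereas the Hartley transforms integrate
  over the completed measure.
\<close>

lemma lebesgue_integrable_representative:
  fixes f :: "real \<Rightarrow> complex"
  assumes "integrable lebesgue f"
  obtains g where "integrable lborel g" "AE x in lebesgue. f x = g x"
proof -
  have "(\<lambda>x. Re (f x)) \<in> borel_measurable lebesgue" "(\<lambda>x. Im (f x)) \<in> borel_measurable lebesgue"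
    using borel_measurable_integrable [OF assms] by simp_all
  then obtain r i where r: "r \<in> borel_measurable lborel" "AE x in lborel. Re (f x) = r x"
    and i: "i \<in> borel_measurable lborel" "AE x in lborel. Im (f x) = i x"
    by (blast dest: completion_ex_borel_measurable_real)
  define g where "g x = Complex (r x) (i x)" for x
  have [measurable]: "g \<in> borel_measurable lborel"
    using r(1) i(1) unfolding g_def [abs_def] borel_measurable_complex_iff by simp
  have AE: "AE x in lebesgue. f x = g x"
    using AE_completion [OF r(2)] AE_completion [OF i(2)]
    by eventually_elim (simp add: g_def complex_eq_iff)
  have "integrable lebesgue g"
    using assms AE by (subst integrable_cong_AE [of g lebesgue f]) (auto intro: measurable_completion)
  then have "integrable lborel g"
    by (subst (asm) integrable_completion) auto
  with AE show thesis
    by (rule that[rotated])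
qed

text \<open>
  Both Hartley transforms at once: \<open>\<sigma> = 1\<close> and \<open>\<sigma> = -1\<close>.
\<close>

definition hartley_kernel :: "real \<Rightarrow> (real \<Rightarrow> complex) \<Rightarrow> real \<Rightarrow> complex" where
  "hartley_kernel \<sigma> f y =
     of_real (1 / sqrt (2 * pi)) * (LINT x|lebesgue. f x * of_real (cos (x * y) + \<sigma> * sin (x * y)))"

lemma hartley_kernel_eq_fourier:
  assumes f: "integrable lborel f"
  shows "hartley_kernel \<sigma> f y = of_real (1 / sqrt (2 * pi)) *
    ((1 + \<sigma> * \<i>) / 2 * fourier f y + (1 - \<sigma> * \<i>) / 2 * fourier f (- y))"
proof -
  have [measurable]: "f \<in> borel_measurable borel" using f by auto
  have "(LINT x|lebesgue. f x * of_real (cos (x * y) + \<sigma> * sin (x * y)))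
      = (LINT x|lborel. f x * of_real (cos (x * y) + \<sigma> * sin (x * y)))"
    by (rule integral_completion) measurable
  also have "\<dots> = (LINT x|lborel. (1 + \<sigma> * \<i>) / 2 * (f x * cis (- (x * y)))
      + (1 - \<sigma> * \<i>) / 2 * (f x * cis (- (x * (- y)))))"
    by (intro Bochner_Integration.integral_cong refl)
      (simp add: complex_eq_iff cis.ctr algebra_simps add_divide_distrib diff_divide_distrib)
  also have "\<dots> = (1 + \<sigma> * \<i>) / 2 * fourier f y + (1 - \<sigma> * \<i>) / 2 * fourier f (- y)"
    unfolding fourier_def using integrable_fourier [OF f, of y] integrable_fourier [OF f, of "- y"]
    by simp
  finally show ?thesis
    by (simp add: hartley_kernel_def)
qed

lemma
  assumes "integrable lborel f"
  shows integrable_reflect: "integrable lborel (\<lambda>x::real. f (- x) :: complex)"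
    and fourier_reflect: "fourier (\<lambda>x. f (- x)) y = fourier f (- y)"
  using lborel_integrable_real_affine [OF assms, of "-1" 0]
    lborel_integral_real_affine [of "-1" "\<lambda>x. f (- x) * cis (- (x * y))" 0]
  by (simp_all add: fourier_def)

lemma hartley_kernel_is_fourier:
  assumes "integrable lebesgue f"
  obtains g where "integrable lborel g" "\<And>y. fourier g y = hartley_kernel \<sigma> f y"
proof -
  obtain f' where f': "integrable lborel f'" "AE x in lebesgue. f x = f' x"
    using lebesgue_integrable_representative [OF assms] by blast
  let ?c = "complex_of_real (1 / sqrt (2 * pi))"
  let ?g = "\<lambda>x. ?c * ((1 + \<sigma> * \<i>) / 2 * f' x + (1 - \<sigma> * \<i>) / 2 * f' (- x))"
  have same: "hartley_kernel \<sigma> f y = hartley_kernel \<sigma> f' y" for y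
  proof -
    let ?k = "\<lambda>x. complex_of_real (cos (x * y) + \<sigma> * sin (x * y))"
    have m: "f \<in> borel_measurable lebesgue" "f' \<in> borel_measurable lebesgue"
      using assms f'(1) by (auto intro: measurable_completion)
    have k: "?k \<in> borel_measurable lebesgue"
      by (rule measurable_completion) measurable
    have "(\<lambda>x. f x * ?k x) \<in> borel_measurable lebesgue"
        "(\<lambda>x. f' x * ?k x) \<in> borel_measurable lebesgue"
      by (rule borel_measurable_times [OF m(1) k], rule borel_measurable_times [OF m(2) k])
    moreover have "AE x in lebesgue. f x * ?k x = f' x * ?k x"
      using f'(2) by eventually_elim simp
    ultimately have "(LINT x|lebesgue. f x * ?k x) = (LINT x|lebesgue. f' x * ?k x)"
      by (rule integral_cong_AE)
    then show ?thesis
      by (simp only: hartley_kernel_def)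
  qed
  show thesis
  proof (rule that [of ?g])
    show "integrable lborel ?g"
      using f'(1) integrable_reflect [OF f'(1)] by simp
    show "fourier ?g y = hartley_kernel \<sigma> f y" for y
      using f'(1) integrable_reflect [OF f'(1)]
      by (simp only: same hartley_kernel_eq_fourier fourier_cmult fourier_add fourier_reflect integrable_mult_right)
  qed
qed

text \<open>
  The coefficients \<open>a = (1 + \<sigma>\<i>)/2\<close> and \<open>b = (1 - \<sigma>\<i>)/2\<close> satisfy \<open>2 a b = 1\<close> and
  \<open>a\<^sup>2 + b\<^sup>2 = 0\<close>, so interchanging them inverts the map that turns a Hartley transform into a
  Fourier transform.
\<close>

lemma fourier_is_hartley_kernel:
  assumes g: "integrable lborel g" and \<sigma>: "\<sigma>\<^sup>2 = 1"
  obtains l where "integrable lebesgue l" "\<And>y. hartley_kernel \<sigma> l y = fourier g y"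
proof -
  define c where "c = complex_of_real (1 / sqrt (2 * pi))"
  have c: "c \<noteq> 0" by (simp add: c_def)
  define l where "l x = inverse c * ((1 - \<sigma> * \<i>) / 2 * g x + (1 + \<sigma> * \<i>) / 2 * g (- x))" for x
  have l: "integrable lborel l"
    unfolding l_def [abs_def] using g integrable_reflect [OF g] by simp
  have fl: "fourier l y = inverse c * ((1 - \<sigma> * \<i>) / 2 * fourier g y + (1 + \<sigma> * \<i>) / 2 * fourier g (- y))" for y
    unfolding l_def [abs_def] using g integrable_reflect [OF g]
    by (simp only: fourier_cmult fourier_add fourier_reflect integrable_mult_right)
  show thesis
  proof (rule that)
    show "integrable lebesgue l"
      using l by (subst integrable_completion) auto
    fix y
    have "complex_of_real \<sigma> * complex_of_real \<sigma> = 1"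
      using \<sigma> by (simp add: power2_eq_square flip: of_real_mult)
    then have sq: "(\<sigma> * \<i>) * (\<sigma> * \<i>) = -1"
      by (simp add: mult_ac)
    have key: "((1 + z) * k) * ((1 - z) * k * s + (1 + z) * k * t)
      + ((1 - z) * k) * ((1 - z) * k * t + (1 + z) * k * s) = s"
      if "z * z = -1" "2 * k = 1" for z k s t :: complex
      using that by algebra
    have alg: "(1 + \<sigma> * \<i>) / 2 * ((1 - \<sigma> * \<i>) / 2 * s + (1 + \<sigma> * \<i>) / 2 * t)
      + (1 - \<sigma> * \<i>) / 2 * ((1 - \<sigma> * \<i>) / 2 * t + (1 + \<sigma> * \<i>) / 2 * s) = s" for s t :: complex
      unfolding divide_inverse by (rule key [OF sq]) simp
    have cancel: "c * (A * (inverse c * X) + B * (inverse c * Y)) = A * X + B * Y" for A B X Y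
      using c by (simp add: field_simps)
    show "hartley_kernel \<sigma> l y = fourier g y"
      unfolding hartley_kernel_eq_fourier [OF l] fl c_def [symmetric] cancel minus_minus
      by (rule alg)
  qed
qed

text \<open>
  Necessity: the zero set \<open>Z\<close> of \<open>1 + H \<phi>\<close> is closed, and its complement is the closed set where
  \<open>H l (1 + H \<phi>) = H \<phi>\<close>, because at points of \<open>Z\<close> this equation reads \<open>0 = -1\<close>.
\<close>

theorem lemma2p1:
  fixes H :: "(real \<Rightarrow> complex) \<Rightarrow> real \<Rightarrow> complex" and \<phi> :: "real \<Rightarrow> complex"
  assumes "H \<in> {hartley1, hartley2}"
    and "integrable lebesgue \<phi>"
  shows "(\<forall>y. 1 + H \<phi> y \<noteq> 0) \<longleftrightarrow>
         (\<exists>l. integrable lebesgue l \<and> (\<forall>y. H l y = H \<phi> y / (1 + H \<phi> y)))"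
proof -
  have "hartley1 = hartley_kernel 1" "hartley2 = hartley_kernel (- 1)"
    by (simp_all add: fun_eq_iff hartley1_def hartley2_def hartley_kernel_def)
  then obtain \<sigma> where H: "H = hartley_kernel \<sigma>" and \<sigma>: "\<sigma>\<^sup>2 = 1"
    using assms(1) by auto
  obtain f where f: "integrable lborel f" "\<And>y. fourier f y = H \<phi> y"
    using hartley_kernel_is_fourier [OF assms(2), of \<sigma>] H by metis
  show ?thesis
  proof
    assume "\<forall>y. 1 + H \<phi> y \<noteq> 0"
    then obtain g where g: "integrable lborel g" "\<And>y. fourier g y = H \<phi> y / (1 + H \<phi> y)"
      using Wiener_reciprocal [OF f(1)] f(2) by metis
    then show "\<exists>l. integrable lebesgue l \<and> (\<forall>y. H l y = H \<phi> y / (1 + H \<phi> y))"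
      using fourier_is_hartley_kernel [OF g(1) \<sigma>] H by metis
  next
    assume "\<exists>l. integrable lebesgue l \<and> (\<forall>y. H l y = H \<phi> y / (1 + H \<phi> y))"
    then obtain l where l: "integrable lebesgue l" "\<And>y. H l y = H \<phi> y / (1 + H \<phi> y)"
      by blast
    obtain g where g: "integrable lborel g" "\<And>y. fourier g y = H l y"
      using hartley_kernel_is_fourier [OF l(1), of \<sigma>] H by metis
    let ?Z = "{y. 1 + H \<phi> y = 0}"
    have cont: "continuous_on UNIV (\<lambda>y. H \<phi> y)" "continuous_on UNIV (\<lambda>y. H l y)"
      using continuous_on_fourier [OF f(1), of UNIV] continuous_on_fourier [OF g(1), of UNIV]
      by (simp_all add: f(2) g(2))
    have "closed ?Z"
      by (intro closed_Collect_eq continuous_intros cont)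
    moreover have "- ?Z = {y. H l y * (1 + H \<phi> y) = H \<phi> y}"
      by (auto simp: l(2) add_eq_0_iff)
    then have "closed (- ?Z)"
      by (simp only:) (intro closed_Collect_eq continuous_intros cont)
    ultimately have "?Z = {} \<or> ?Z = UNIV"
      using clopen [of ?Z] by (simp add: open_closed)
    moreover have "?Z \<noteq> UNIV"
    proof
      assume "?Z = UNIV"
      then have "1 + fourier f y = 0" for y
        using f(2) by auto
      then have one: "norm (fourier f y) = 1" for y
        by (metis add_eq_0_iff norm_minus_cancel norm_one)
      obtain R where "0 \<le> R" "\<And>y. R < \<bar>y\<bar> \<Longrightarrow> norm (fourier f y) < 1"
        using Riemann_Lebesgue [OF f(1), of 1] by auto
      then have "norm (fourier f (R + 1)) < 1"
        by simp
      with one show False by simp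
    qed
    ultimately show "\<forall>y. 1 + H \<phi> y \<noteq> 0"
      by blast
  qed
qed

end
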